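(* Let $H=\mathfrak{H}+h\circ\pi$ be a simple function on $T^{\ast}Q$ and let $W\subset T^{\ast}Q$ be a linear subbundle. Let $\hat H=\hat{\mathfrak{H}}+\hat h\circ\pi:T^{\ast}Q\to\mathbb{R}$ be a simple function and $\mu:T^{\ast}Q\to\mathbb{R}$ a non-negative function. If there exists a fiber preserving map $y:T^{\ast}Q\to T^{\ast}Q$ such that $\langle y(\alpha),\mathbb{F}\hat H(\alpha)\rangle=-\mu(\alpha)-\{\hat H,H\}(\alpha)$ and $y(\alpha)\in W_{\pi(\alpha)}$ for all $\alpha\in T^{\ast}Q$, then, for every torsion-free connection, $$\langle\mathbb{B}\hat{\mathfrak{H}}(\sigma),\mathbb{F}\mathfrak{H}(\sigma)\rangle-\langle\mathbb{B}\mathfrak{H}(\sigma),\mathbb{F}\hat{\mathfrak{H}}(\sigma)\rangle=0$$ and $$\langle d\hat h(\pi(\sigma)),\mathbb{F}\mathfrak{H}(\sigma)\rangle-\langle dh(\pi(\sigma)),\mathbb{F}\hat{\mathfrak{H}}(\sigma)\rangle=0$$ for all $\sigma\in\hat W:=\mathbb{F}\hat{\mathfrak{H}}^{-1}(W^0)$.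
   Context: All manifolds are smooth and finite dimensional and all maps are smooth. $\pi:T^{\ast}Q\to Q$ is the projection. A function on $T^{\ast}Q$ is simple if it has the form $\mathfrak{H}+h\circ\pi$ with $h\in C^\infty(Q)$ and $\mathfrak{H}(\alpha)=\frac12\langle\alpha,\rho^\sharp(\alpha)\rangle$ for a Riemannian metric $\rho$ on $Q$ (for $\hat H$ the metric is denoted $\hat\rho$). Fiber derivative of $F:T^{\ast}Q\to\mathbb{R}$: $\mathbb{F}F:T^{\ast}Q\to TQ$, $\langle\sigma,\mathbb{F}F(\alpha)\rangle=\frac{d}{ds}|_{0}F(\alpha+s\sigma)$; so $\mathbb{F}\hat H=\mathbb{F}\hat{\mathfrak{H}}=\hat\rho^\sharp$. Base derivative, given a connection on $TQ$ and its dual on $T^{\ast}Q$: $\mathbb{B}F:T^{\ast}Q\to T^{\ast}Q$, $\langle\mathbb{B}F(\alpha),v\rangle=\frac{d}{ds}|_0F(u(s))$ where $u$ is a horizontal (parallel) curve in $T^{\ast}Q$ with $u(0)=\alpha$ whose projection to $Q$ has velocity $v$ at $s=0$. $W^0\subset TQ$ is the annihilator of $W$. $\{F,G\}=\frac{\partial F}{\partial q^i}\frac{\partial G}{\partial p_i}-\frac{\partial G}{\partial q^i}\frac{\partial F}{\partial p_i}$. Fiber preserving means $\pi\circ y=\pi$. *)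

theory Defs
  imports "HOL-Analysis.Analysis" "HOL-Library.Function_Algebras"
begin

(* Pointwise vector space structure on functions; tangent vectors and covectors below are
   functions, so that subspace, span and independent apply to them. *)

instantiation "fun" :: (type, scaleR) scaleR
begin
definition scaleR_fun where "scaleR r f = (\<lambda>x. r *\<^sub>R f x)"
instance ..
end

instance "fun" :: (type, real_vector) real_vector
  by standard
     (auto simp: scaleR_fun_def plus_fun_def fun_eq_iff scaleR_add_right scaleR_add_left)


section \<open>Smooth manifolds\<close>

(* C^k on an open set; the second equation asks for all directional derivatives to be C^k. *)
primrec Ck_on :: "nat \<Rightarrow> 'a::real_normed_vector set \<Rightarrow> ('a \<Rightarrow> 'b::real_normed_vector) \<Rightarrow> bool"
  where
    "Ck_on 0 S f \<longleftrightarrow> continuous_on S f"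
  | "Ck_on (Suc k) S f \<longleftrightarrow>
       (\<forall>x\<in>S. f differentiable (at x)) \<and>
       (\<forall>v. Ck_on k S (\<lambda>x. frechet_derivative f (at x) v))"

definition smooth_on :: "'a::real_normed_vector set \<Rightarrow> ('a \<Rightarrow> 'b::real_normed_vector) \<Rightarrow> bool"
  where "smooth_on S f \<longleftrightarrow> (\<forall>k. Ck_on k S f)"

(* A chart is a pair of its domain and its coordinate map; the map is arbitrary off the domain. *)
type_synonym ('q, 'e) chart = "'q set \<times> ('q \<Rightarrow> 'e)"

definition chart_inv :: "('q, 'e) chart \<Rightarrow> 'e \<Rightarrow> 'q"
  where "chart_inv c = inv_into (fst c) (snd c)"

definition transition :: "('q, 'e) chart \<Rightarrow> ('q, 'e) chart \<Rightarrow> 'e \<Rightarrow> 'e"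
  where "transition c d = snd d \<circ> chart_inv c"

(* The underlying point set of the manifold described by an atlas. *)
definition points :: "('q, 'e) chart set \<Rightarrow> 'q set"
  where "points A = (\<Union>c\<in>A. fst c)"

definition atlas_topology :: "('q, 'e::euclidean_space) chart set \<Rightarrow> 'q topology"
  where "atlas_topology A =
    topology_generated_by {{x \<in> fst c. snd c x \<in> V} | c V. c \<in> A \<and> open V}"

definition countable_base :: "'q topology \<Rightarrow> bool"
  where "countable_base X \<longleftrightarrow>
    (\<exists>B. countable B \<and> (\<forall>V\<in>B. openin X V) \<and>
         (\<forall>U x. openin X U \<and> x \<in> U \<longrightarrow> (\<exists>V\<in>B. x \<in> V \<and> V \<subseteq> U)))"

definition smooth_manifold :: "('q, 'e::euclidean_space) chart set \<Rightarrow> bool"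
  where "smooth_manifold A \<longleftrightarrow>
    (\<forall>c\<in>A. inj_on (snd c) (fst c) \<and> open (snd c ` fst c)) \<and>
    (\<forall>c\<in>A. \<forall>d\<in>A. open (snd c ` (fst c \<inter> fst d)) \<and>
       smooth_on (snd c ` (fst c \<inter> fst d)) (transition c d)) \<and>
    Hausdorff_space (atlas_topology A) \<and> countable_base (atlas_topology A)"

(* Smoothness, on an open set U, of a map between the manifolds with atlases A and B.
   Openness of the domains of the local representatives amounts to continuity. *)
definition smooth_map_on ::
  "('q, 'e::euclidean_space) chart set \<Rightarrow> 'q set \<Rightarrow> ('r, 'f::euclidean_space) chart set \<Rightarrow>
   ('q \<Rightarrow> 'r) \<Rightarrow> bool"
  where "smooth_map_on A U B f \<longleftrightarrow>
    openin (atlas_topology A) U \<and> f ` U \<subseteq> points B \<and>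
    (\<forall>c\<in>A. \<forall>d\<in>B. let S = snd c ` {x \<in> fst c \<inter> U. f x \<in> fst d}
       in open S \<and> smooth_on S (snd d \<circ> f \<circ> chart_inv c))"

definition smooth_map ::
  "('q, 'e::euclidean_space) chart set \<Rightarrow> ('r, 'f::euclidean_space) chart set \<Rightarrow>
   ('q \<Rightarrow> 'r) \<Rightarrow> bool"
  where "smooth_map A B f \<longleftrightarrow> smooth_map_on A (points A) B f"

definition euclidean_atlas :: "('e::euclidean_space, 'e) chart set"
  where "euclidean_atlas = {(UNIV, id)}"

definition smooth_fun_on :: "('q, 'e::euclidean_space) chart set \<Rightarrow> 'q set \<Rightarrow> ('q \<Rightarrow> real) \<Rightarrow> bool"
  where "smooth_fun_on A U f \<longleftrightarrow> smooth_map_on A U euclidean_atlas f"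

definition smooth_fun :: "('q, 'e::euclidean_space) chart set \<Rightarrow> ('q \<Rightarrow> real) \<Rightarrow> bool"
  where "smooth_fun A f \<longleftrightarrow> smooth_fun_on A (points A) f"

(* Some chart of the atlas around q. It only serves to evaluate expressions whose value is the
   same in every chart around q. *)
definition chart_at :: "('q, 'e) chart set \<Rightarrow> 'q \<Rightarrow> ('q, 'e) chart"
  where "chart_at A q = (SOME c. c \<in> A \<and> q \<in> fst c)"


section \<open>Tangent and cotangent bundles\<close>

(* A tangent vector at q is the family of its component vectors in the charts around q, which
   transform by the derivatives of the transition maps; it is 0 at all other indices. *)
type_synonym ('q, 'e) tvec = "('q, 'e) chart \<Rightarrow> 'e"

definition tangent_space :: "('q, 'e::euclidean_space) chart set \<Rightarrow> 'q \<Rightarrow> ('q, 'e) tvec set"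
  where "tangent_space A q =
    {v. (\<forall>c\<in>A. \<forall>d\<in>A. q \<in> fst c \<inter> fst d \<longrightarrow>
           v d = frechet_derivative (transition c d) (at (snd c q)) (v c)) \<and>
        (\<forall>c. \<not> (c \<in> A \<and> q \<in> fst c) \<longrightarrow> v c = 0)}"

(* The tangent vector at q with component vector x in the chart c. *)
definition tangent_of ::
  "('q, 'e::euclidean_space) chart set \<Rightarrow> ('q, 'e) chart \<Rightarrow> 'q \<Rightarrow> 'e \<Rightarrow> ('q, 'e) tvec"
  where "tangent_of A c q x =
    (\<lambda>d. if d \<in> A \<and> q \<in> fst d
         then frechet_derivative (transition c d) (at (snd c q)) x else 0)"

definition tangent_bundle :: "('q, 'e::euclidean_space) chart set \<Rightarrow> ('q \<times> ('q, 'e) tvec) set"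
  where "tangent_bundle A = Sigma (points A) (tangent_space A)"

definition tangent_atlas ::
  "('q, 'e::euclidean_space) chart set \<Rightarrow> ('q \<times> ('q, 'e) tvec, 'e \<times> 'e) chart set"
  where "tangent_atlas A =
    (\<lambda>c. (Sigma (fst c) (tangent_space A), \<lambda>(q, v). (snd c q, v c))) ` A"

(* Covectors are linear forms on the tangent space, extended by 0. *)
type_synonym ('q, 'e) cvec = "('q, 'e) tvec \<Rightarrow> real"

definition cotangent_space :: "('q, 'e::euclidean_space) chart set \<Rightarrow> 'q \<Rightarrow> ('q, 'e) cvec set"
  where "cotangent_space A q =
    {\<alpha>. (\<forall>v\<in>tangent_space A q. \<forall>w\<in>tangent_space A q. \<forall>a b.
           \<alpha> (a *\<^sub>R v + b *\<^sub>R w) = a * \<alpha> v + b * \<alpha> w) \<and>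
        (\<forall>v. v \<notin> tangent_space A q \<longrightarrow> \<alpha> v = 0)}"

definition cotangent_bundle :: "('q, 'e::euclidean_space) chart set \<Rightarrow> ('q \<times> ('q, 'e) cvec) set"
  where "cotangent_bundle A = Sigma (points A) (cotangent_space A)"

(* The chart (q^i, p_i) of the cotangent bundle induced by c = (q^i), with p_i(\<alpha>) the value
   of \<alpha> on the i-th coordinate vector. *)
definition cotangent_chart ::
  "('q, 'e::euclidean_space) chart set \<Rightarrow> ('q, 'e) chart \<Rightarrow> ('q \<times> ('q, 'e) cvec, 'e \<times> 'e) chart"
  where "cotangent_chart A c =
    (Sigma (fst c) (cotangent_space A),
     \<lambda>(q, \<alpha>). (snd c q, \<Sum>i\<in>Basis. \<alpha> (tangent_of A c q i) *\<^sub>R i))"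

definition cotangent_atlas ::
  "('q, 'e::euclidean_space) chart set \<Rightarrow> ('q \<times> ('q, 'e) cvec, 'e \<times> 'e) chart set"
  where "cotangent_atlas A = cotangent_chart A ` A"

(* Natural pairing of a covector with a tangent vector at the same point. *)
definition pairing :: "'q \<times> ('q, 'e) cvec \<Rightarrow> 'q \<times> ('q, 'e) tvec \<Rightarrow> real"
  where "pairing z w = snd z (snd w)"

definition differential ::
  "('q, 'e::euclidean_space) chart set \<Rightarrow> ('q \<Rightarrow> real) \<Rightarrow> 'q \<Rightarrow> 'q \<times> ('q, 'e) cvec"
  where "differential A f q =
    (q, \<lambda>v. if v \<in> tangent_space A q
            then let c = chart_at A q
                 in frechet_derivative (f \<circ> chart_inv c) (at (snd c q)) (v c)
            else 0)"

definition velocity ::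
  "('q, 'e::euclidean_space) chart set \<Rightarrow> (real \<Rightarrow> 'q) \<Rightarrow> real \<Rightarrow> 'q \<times> ('q, 'e) tvec"
  where "velocity A \<gamma> s =
    (\<gamma> s, \<lambda>c. if c \<in> A \<and> \<gamma> s \<in> fst c then vector_derivative (snd c \<circ> \<gamma>) (at s) else 0)"

definition vector_field_on ::
  "('q, 'e::euclidean_space) chart set \<Rightarrow> 'q set \<Rightarrow> ('q \<Rightarrow> ('q, 'e) tvec) \<Rightarrow> bool"
  where "vector_field_on A U X \<longleftrightarrow> smooth_map_on A U (tangent_atlas A) (\<lambda>q. (q, X q))"

definition one_form_on ::
  "('q, 'e::euclidean_space) chart set \<Rightarrow> 'q set \<Rightarrow> ('q \<Rightarrow> ('q, 'e) cvec) \<Rightarrow> bool"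
  where "one_form_on A U \<theta> \<longleftrightarrow> smooth_map_on A U (cotangent_atlas A) (\<lambda>q. (q, \<theta> q))"

(* Linear subbundles of the cotangent bundle: subsets that are locally, fibre by fibre, the span
   of a smooth frame. *)
definition linear_subbundle ::
  "('q, 'e::euclidean_space) chart set \<Rightarrow> ('q \<times> ('q, 'e) cvec) set \<Rightarrow> bool"
  where "linear_subbundle A W \<longleftrightarrow> W \<subseteq> cotangent_bundle A \<and>
    (\<forall>q\<in>points A. \<exists>U k \<theta>. openin (atlas_topology A) U \<and> q \<in> U \<and>
       (\<forall>i<k::nat. one_form_on A U (\<theta> i)) \<and>
       (\<forall>x\<in>U. inj_on (\<lambda>i. \<theta> i x) {..<k} \<and> independent ((\<lambda>i. \<theta> i x) ` {..<k}) \<and>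
              {\<alpha>. (x, \<alpha>) \<in> W} = span ((\<lambda>i. \<theta> i x) ` {..<k})))"

definition annihilator ::
  "('q, 'e::euclidean_space) chart set \<Rightarrow> ('q \<times> ('q, 'e) cvec) set \<Rightarrow> ('q \<times> ('q, 'e) tvec) set"
  where "annihilator A W =
    {w \<in> tangent_bundle A. \<forall>\<alpha>. (fst w, \<alpha>) \<in> W \<longrightarrow> pairing (fst w, \<alpha>) w = 0}"


section \<open>Simple functions\<close>

definition riemannian_metric ::
  "('q, 'e::euclidean_space) chart set \<Rightarrow> ('q \<Rightarrow> ('q, 'e) tvec \<Rightarrow> ('q, 'e) tvec \<Rightarrow> real) \<Rightarrow> bool"
  where "riemannian_metric A \<rho> \<longleftrightarrow>
    (\<forall>q\<in>points A. \<forall>u\<in>tangent_space A q. \<forall>v\<in>tangent_space A q. \<forall>w\<in>tangent_space A q. \<forall>a b.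
       \<rho> q (a *\<^sub>R u + b *\<^sub>R v) w = a * \<rho> q u w + b * \<rho> q v w) \<and>
    (\<forall>q\<in>points A. \<forall>u\<in>tangent_space A q. \<forall>v\<in>tangent_space A q. \<rho> q u v = \<rho> q v u) \<and>
    (\<forall>q\<in>points A. \<forall>u\<in>tangent_space A q. u \<noteq> 0 \<longrightarrow> \<rho> q u u > 0) \<and>
    (\<forall>U X Y. vector_field_on A U X \<and> vector_field_on A U Y \<longrightarrow>
       smooth_fun_on A U (\<lambda>q. \<rho> q (X q) (Y q)))"

definition sharp ::
  "('q, 'e::euclidean_space) chart set \<Rightarrow> ('q \<Rightarrow> ('q, 'e) tvec \<Rightarrow> ('q, 'e) tvec \<Rightarrow> real) \<Rightarrow>
   'q \<times> ('q, 'e) cvec \<Rightarrow> 'q \<times> ('q, 'e) tvec"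
  where "sharp A \<rho> z =
    (fst z, THE v. v \<in> tangent_space A (fst z) \<and>
                   (\<forall>w\<in>tangent_space A (fst z). \<rho> (fst z) v w = snd z w))"

definition kinetic ::
  "('q, 'e::euclidean_space) chart set \<Rightarrow> ('q \<Rightarrow> ('q, 'e) tvec \<Rightarrow> ('q, 'e) tvec \<Rightarrow> real) \<Rightarrow>
   'q \<times> ('q, 'e) cvec \<Rightarrow> real"
  where "kinetic A \<rho> z = 1/2 * pairing z (sharp A \<rho> z)"

definition simple_hamiltonian ::
  "('q, 'e::euclidean_space) chart set \<Rightarrow> ('q \<Rightarrow> ('q, 'e) tvec \<Rightarrow> ('q, 'e) tvec \<Rightarrow> real) \<Rightarrow>
   ('q \<Rightarrow> real) \<Rightarrow> 'q \<times> ('q, 'e) cvec \<Rightarrow> real"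
  where "simple_hamiltonian A \<rho> h = (\<lambda>z. kinetic A \<rho> z + h (fst z))"


section \<open>Poisson bracket and fiber derivative\<close>

(* In the coordinates (q^i, p_i) induced by a chart around the base point. *)
definition poisson_bracket ::
  "('q, 'e::euclidean_space) chart set \<Rightarrow> ('q \<times> ('q, 'e) cvec \<Rightarrow> real) \<Rightarrow>
   ('q \<times> ('q, 'e) cvec \<Rightarrow> real) \<Rightarrow> 'q \<times> ('q, 'e) cvec \<Rightarrow> real"
  where "poisson_bracket A F G z =
    (let c = cotangent_chart A (chart_at A (fst z));
         dq = (\<lambda>K i. frechet_derivative (K \<circ> chart_inv c) (at (snd c z)) (i, 0));
         dp = (\<lambda>K i. frechet_derivative (K \<circ> chart_inv c) (at (snd c z)) (0, i))
     in \<Sum>i\<in>Basis. dq F i * dp G i - dq G i * dp F i)"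

definition fiber_derivative ::
  "('q, 'e::euclidean_space) chart set \<Rightarrow> ('q \<times> ('q, 'e) cvec \<Rightarrow> real) \<Rightarrow>
   'q \<times> ('q, 'e) cvec \<Rightarrow> 'q \<times> ('q, 'e) tvec"
  where "fiber_derivative A F z =
    (THE w. w \<in> tangent_bundle A \<and> fst w = fst z \<and>
       (\<forall>\<beta>\<in>cotangent_space A (fst z).
          ((\<lambda>s. F (fst z, snd z + s *\<^sub>R \<beta>)) has_real_derivative pairing (fst z, \<beta>) w) (at 0)))"


section \<open>Connections and base derivative\<close>

type_synonym ('q, 'e) connection =
  "'q \<times> ('q, 'e) tvec \<Rightarrow> ('q \<Rightarrow> ('q, 'e) tvec) \<Rightarrow> ('q, 'e) tvec"

(* Covariant derivatives of vector fields, as operators on local vector fields (a connection on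
   globally defined fields extends uniquely to these): nabla (q, v) Y is meaningful whenever
   Y is a smooth field on some open neighbourhood U of q. *)
definition is_connection :: "('q, 'e::euclidean_space) chart set \<Rightarrow> ('q, 'e) connection \<Rightarrow> bool"
  where "is_connection A nabla \<longleftrightarrow>
    (\<forall>U Y q. vector_field_on A U Y \<and> q \<in> U \<longrightarrow>
      (\<forall>v\<in>tangent_space A q. nabla (q, v) Y \<in> tangent_space A q) \<and>
      (\<forall>v\<in>tangent_space A q. \<forall>w\<in>tangent_space A q. \<forall>a b.
         nabla (q, a *\<^sub>R v + b *\<^sub>R w) Y = a *\<^sub>R nabla (q, v) Y + b *\<^sub>R nabla (q, w) Y) \<and>
      (\<forall>Z. vector_field_on A U Z \<longrightarrow> (\<forall>v\<in>tangent_space A q.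
         nabla (q, v) (Y + Z) = nabla (q, v) Y + nabla (q, v) Z)) \<and>
      (\<forall>f. smooth_fun_on A U f \<longrightarrow> (\<forall>v\<in>tangent_space A q.
         nabla (q, v) (\<lambda>x. f x *\<^sub>R Y x) =
           pairing (differential A f q) (q, v) *\<^sub>R Y q + f q *\<^sub>R nabla (q, v) Y)) \<and>
      (\<forall>Z. (\<forall>x\<in>U. Z x = Y x) \<longrightarrow> (\<forall>v\<in>tangent_space A q. nabla (q, v) Z = nabla (q, v) Y))) \<and>
    (\<forall>U X Y. vector_field_on A U X \<and> vector_field_on A U Y \<longrightarrow>
       vector_field_on A U (\<lambda>q. nabla (q, X q) Y))"

(* nabla_X Y - nabla_Y X = [X, Y], where [X, Y] f = X (Y f) - Y (X f). *)
definition torsion_free :: "('q, 'e::euclidean_space) chart set \<Rightarrow> ('q, 'e) connection \<Rightarrow> bool"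
  where "torsion_free A nabla \<longleftrightarrow>
    (\<forall>U X Y f. vector_field_on A U X \<and> vector_field_on A U Y \<and> smooth_fun_on A U f \<longrightarrow>
      (\<forall>q\<in>U.
        pairing (differential A f q) (q, nabla (q, X q) Y - nabla (q, Y q) X) =
        pairing (differential A (\<lambda>x. pairing (differential A f x) (x, Y x)) q) (q, X q) -
        pairing (differential A (\<lambda>x. pairing (differential A f x) (x, X x)) q) (q, Y q)))"

(* u is parallel over ]-e, e[ for the dual connection. The dual covariant derivative of u along
   its projection g to the base is given by <Du/ds, Y> = d/ds <u, Y o g> - <u, nabla_{g'} Y>
   for local vector fields Y; it is required to vanish. *)
definition horizontal_curve ::
  "('q, 'e::euclidean_space) chart set \<Rightarrow> ('q, 'e) connection \<Rightarrow> real \<Rightarrow>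
   (real \<Rightarrow> 'q \<times> ('q, 'e) cvec) \<Rightarrow> bool"
  where "horizontal_curve A nabla e u \<longleftrightarrow>
    smooth_map_on euclidean_atlas {-e<..<e} (cotangent_atlas A) u \<and>
    (\<forall>s\<in>{-e<..<e}. \<forall>U Y. vector_field_on A U Y \<and> fst (u s) \<in> U \<longrightarrow>
      ((\<lambda>t. pairing (u t) (fst (u t), Y (fst (u t)))) has_real_derivative
         pairing (u s) (fst (u s), nabla (velocity A (fst \<circ> u) s) Y)) (at s))"

definition base_derivative ::
  "('q, 'e::euclidean_space) chart set \<Rightarrow> ('q, 'e) connection \<Rightarrow>
   ('q \<times> ('q, 'e) cvec \<Rightarrow> real) \<Rightarrow> 'q \<times> ('q, 'e) cvec \<Rightarrow> 'q \<times> ('q, 'e) cvec"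
  where "base_derivative A nabla F z =
    (THE b. b \<in> cotangent_bundle A \<and> fst b = fst z \<and>
       (\<forall>v\<in>tangent_space A (fst z). \<forall>e>0. \<forall>u.
          horizontal_curve A nabla e u \<and> u 0 = z \<and> velocity A (fst \<circ> u) 0 = (fst z, v) \<longrightarrow>
          ((F \<circ> u) has_real_derivative pairing b (fst z, v)) (at 0)))"

end

theory Submission
  imports Defs
begin

text \<open>Where the fiber derivative of \<open>H'\<close> annihilates \<open>W\<close>, the term with \<open>y\<close> vanishes, so the
  bracket of the two simple functions equals \<open>-\<mu>\<close> and is nonpositive. Along the line \<open>t \<sigma>\<close> it is
  \<open>t\<^sup>3 P\<^sub>3 + t P\<^sub>1\<close>, where \<open>P\<^sub>3\<close> is the bracket of the kinetic energies and \<open>P\<^sub>1\<close> collects the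
  potential terms. An odd polynomial that is nonpositive for all \<open>t \<noteq> 0\<close> vanishes, hence
  \<open>P\<^sub>3 = P\<^sub>1 = 0\<close>. For a torsion-free connection \<open>P\<^sub>3\<close> is the difference of the base derivatives
  paired with the fiber derivatives. That the base derivative is well defined rests on the
  existence of horizontal lifts, i.e. on linear differential equations.\<close>

subsection \<open>Calculus of smooth functions\<close>

text \<open>The sharp map, the fiber derivative and the base derivative are definite descriptions
  (\<open>THE\<close>), so they can be used only after existence and uniqueness have been shown. All
  are computed in one cotangent chart: if \<open>L\<close> is the derivative of a function there,
  its fiber derivative has the components \<open>L (0, i)\<close>, and its base derivative is
  \<open>L\<close> applied to the coordinate velocity of a horizontal curve. This velocity turns out
  to depend only on the covector and on the velocity of the base curve, so all horizontal curves
  give the same value, and one curve per direction determines it. The kinetic energy is given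
  through the inverse of the metric, so even its differentiability needs an argument. The inequality
  is available on the whole line through \<sigma> because the fiber derivative of \<open>H'\<close>
  is linear on each fiber: multiples of \<sigma> keep it in the annihilator of \<open>W\<close>. The
  value t = 0 is left out because derivatives at \<open>t \<sigma>\<close> are obtained from those
  at \<sigma> by rescaling momenta with 1/t.\<close>

lemma Ck_on_subset: "Ck_on k S f \<Longrightarrow> T \<subseteq> S \<Longrightarrow> Ck_on k T f"
  by (induction k arbitrary: f) (auto intro: continuous_on_subset)

text \<open>Differentiability and \<open>frechet_derivative\<close> refer to the full filter
  \<open>at x\<close>, so agreement on \<open>S\<close> transfers them because \<open>S\<close> is a
  neighbourhood of each of its points. Openness recurs below for this reason.\<close>

lemma Ck_on_cong:
  assumes "open S" "\<And>x. x \<in> S \<Longrightarrow> f x = g x" "Ck_on k S f"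
  shows "Ck_on k S g"
  using assms(2,3)
proof (induction k arbitrary: f g)
  case 0
  then show ?case by (simp cong: continuous_on_cong)
next
  case (Suc k)
  have d: "g differentiable (at x)" if "x \<in> S" for x
  proof -
    have "f differentiable (at x)" using Suc.prems that by simp
    then show ?thesis
      by (metis differentiable_def has_derivative_transform_within_open assms(1) that Suc.prems(1))
  qed
  have e: "frechet_derivative f (at x) = frechet_derivative g (at x)" if "x \<in> S" for x
    using Suc.prems that assms(1) by (intro frechet_derivative_transform_within_open) auto
  have "Ck_on k S (\<lambda>x. frechet_derivative g (at x) v)" for v
    using Suc.IH[of "\<lambda>x. frechet_derivative f (at x) v"] Suc.prems(2) e by simp
  then show ?case using d by simp
qed

lemma Ck_on_Suc_lower: "Ck_on (Suc k) S f \<Longrightarrow> Ck_on k S f"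
proof (induction k arbitrary: f)
  case 0
  then show ?case
    by (auto simp: continuous_on_eq_continuous_within differentiable_imp_continuous_within
        intro: continuous_at_imp_continuous_within)
qed (metis Ck_on.simps(2))

text \<open>Lets the inductions below supply an explicitly calculated derivative; uniqueness
  identifies it with \<open>frechet_derivative\<close> on the open set.\<close>

lemma Ck_on_SucI:
  assumes "open S" "\<And>x. x \<in> S \<Longrightarrow> (f has_derivative f' x) (at x)"
    "\<And>v. Ck_on k S (\<lambda>x. f' x v)"
  shows "Ck_on (Suc k) S f"
proof -
  have "f' x = frechet_derivative f (at x)" if "x \<in> S" for x
    using assms(2) that frechet_derivative_at by blast
  then have "Ck_on k S (\<lambda>x. frechet_derivative f (at x) v)" for v
    using Ck_on_cong[OF assms(1) _ assms(3)] by simp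
  then show ?thesis using assms(2) by (auto simp: differentiable_def)
qed

lemma Ck_on_has_derivative:
  "Ck_on (Suc k) S f \<Longrightarrow> x \<in> S \<Longrightarrow> (f has_derivative frechet_derivative f (at x)) (at x)"
  by (simp flip: frechet_derivative_works)

lemma Ck_on_const: "open S \<Longrightarrow> Ck_on k S (\<lambda>x. c)"
proof (induction k arbitrary: c)
  case (Suc k)
  show ?case
    by (rule Ck_on_SucI[OF Suc.prems, of _ "\<lambda>x v. 0"]) (auto intro: Suc)
qed simp

lemma Ck_on_linear:
  assumes "open S" "bounded_linear f" shows "Ck_on k S f"
proof (cases k)
  case 0
  then show ?thesis using assms by (simp add: linear_continuous_on)
next
  case (Suc k)
  show ?thesis unfolding Suc
    by (rule Ck_on_SucI[OF assms(1), of _ "\<lambda>x. f"])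
      (auto intro: bounded_linear_imp_has_derivative assms Ck_on_const)
qed

lemma Ck_on_add:
  assumes "open S" "Ck_on k S f" "Ck_on k S g"
  shows "Ck_on k S (\<lambda>x. f x + g x)"
  using assms(2-)
proof (induction k arbitrary: f g)
  case (Suc k)
  note d = Suc.prems[THEN Ck_on_has_derivative]
  show ?case
    by (rule Ck_on_SucI[OF assms(1) has_derivative_add[OF d]]) (use Suc in auto)
qed (auto intro: continuous_intros)

lemma Ck_on_sum:
  assumes "open S" "\<And>i. i \<in> I \<Longrightarrow> Ck_on k S (f i)"
  shows "Ck_on k S (\<lambda>x. \<Sum>i\<in>I. f i x)"
  using assms(2) by (induction I rule: infinite_finite_induct)
    (auto intro: Ck_on_add Ck_on_const assms(1))

text \<open>Product rule: each summand of the derivative couples one factor with a directional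
  derivative of the other. The undifferentiated factor is then used one order lower, through
  \<open>Ck_on_Suc_lower\<close>.\<close>

lemma Ck_on_bilinear:
  assumes "open S" "bounded_bilinear b" "Ck_on k S f" "Ck_on k S g"
  shows "Ck_on k S (\<lambda>x. b (f x) (g x))"
  using assms(3-)
proof (induction k arbitrary: f g)
  case 0
  then show ?case using bounded_bilinear.continuous_on[OF assms(2)] by auto
next
  case (Suc k)
  note d = Suc.prems[THEN Ck_on_has_derivative]
  show ?case
    by (rule Ck_on_SucI[OF assms(1) bounded_bilinear.FDERIV[OF assms(2) d]])
      (use Suc.prems Suc.prems[THEN Ck_on_Suc_lower] in
        \<open>auto intro!: Ck_on_add[OF assms(1)] Suc.IH simp del: Ck_on.simps simp: Ck_on.simps(2)[of k]\<close>)
qed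

lemma linear_Basis_expand:
  fixes v :: "'a::euclidean_space"
  assumes "linear l"
  shows "l v = (\<Sum>i\<in>Basis. (v \<bullet> i) *\<^sub>R l i)"
proof -
  have "l v = l (\<Sum>i\<in>Basis. (v \<bullet> i) *\<^sub>R i)" by (simp add: euclidean_representation)
  also have "\<dots> = (\<Sum>i\<in>Basis. (v \<bullet> i) *\<^sub>R l i)"
    by (simp only: linear_sum[OF assms] linear_cmul[OF assms])
  finally show ?thesis .
qed

text \<open>\<open>Ck_on\<close> speaks of derivatives in fixed directions, but the chain rule
  applies the derivative of \<open>g\<close> to a vector that moves with \<open>x\<close>. Expanding
  this vector over \<open>Basis\<close> leaves scalar coefficients times derivatives of
  \<open>g\<close> in fixed directions, to which the induction hypothesis applies; hence the
  Euclidean space in the middle.\<close>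

lemma Ck_on_compose:
  fixes f :: "'a::real_normed_vector \<Rightarrow> 'b::euclidean_space"
  assumes "open S" "Ck_on k S f" "Ck_on k T g" "f ` S \<subseteq> T"
  shows "Ck_on k S (\<lambda>x. g (f x))"
  using assms(2-)
proof (induction k arbitrary: f g)
  case 0
  then show ?case using continuous_on_compose2 by auto
next
  case (Suc k)
  show ?case
  proof (rule Ck_on_SucI[OF assms(1)])
    fix x assume x: "x \<in> S"
    have "(f has_derivative frechet_derivative f (at x)) (at x)"
      "(g has_derivative frechet_derivative g (at (f x))) (at (f x))"
      using Suc.prems x by (auto intro: Ck_on_has_derivative simp del: Ck_on.simps)
    from diff_chain_at[OF this]
    show "((\<lambda>x. g (f x)) has_derivative
        (\<lambda>v. \<Sum>i\<in>Basis. (frechet_derivative f (at x) v \<bullet> i) *\<^sub>R frechet_derivative g (at (f x)) i)) (at x)"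
    proof -
      assume *: "(g \<circ> f has_derivative
           frechet_derivative g (at (f x)) \<circ> frechet_derivative f (at x)) (at x)"
      have "bounded_linear (frechet_derivative g (at (f x)))"
        using Suc.prems x Ck_on_has_derivative has_derivative_bounded_linear by blast
      then have l: "linear (frechet_derivative g (at (f x)))" by (rule bounded_linear.linear)
      show ?thesis
        by (rule has_derivative_eq_rhs[OF *[unfolded o_def]])
          (rule ext, rule linear_Basis_expand[OF l])
    qed
  next
    fix v
    have "Ck_on k S (\<lambda>x. frechet_derivative g (at (f x)) i)" for i
      using Suc.IH[OF Ck_on_Suc_lower[OF Suc.prems(1)], of "\<lambda>x. frechet_derivative g (at x) i"]
        Suc.prems by simp
    moreover have "Ck_on k S (\<lambda>x. frechet_derivative f (at x) v \<bullet> i)" for i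
      using Suc.prems by (intro Ck_on_bilinear[OF assms(1) bounded_bilinear_inner] Ck_on_const assms) auto
    ultimately show "Ck_on k S (\<lambda>x. \<Sum>i\<in>Basis. (frechet_derivative f (at x) v \<bullet> i) *\<^sub>R
        frechet_derivative g (at (f x)) i)"
      by (intro Ck_on_sum assms(1) Ck_on_bilinear[OF assms(1) bounded_bilinear_scaleR])
  qed
qed

lemma smooth_on_subset: "smooth_on S f \<Longrightarrow> T \<subseteq> S \<Longrightarrow> smooth_on T f"
  using Ck_on_subset unfolding smooth_on_def by blast

lemma smooth_on_cong:
  "smooth_on S f \<Longrightarrow> open S \<Longrightarrow> (\<And>x. x \<in> S \<Longrightarrow> g x = f x) \<Longrightarrow> smooth_on S g"
  using Ck_on_cong[of S f g] unfolding smooth_on_def by auto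

lemma smooth_on_const: "open S \<Longrightarrow> smooth_on S (\<lambda>x. c)"
  by (simp add: smooth_on_def Ck_on_const)

lemma smooth_on_linear: "open S \<Longrightarrow> bounded_linear f \<Longrightarrow> smooth_on S f"
  by (simp add: smooth_on_def Ck_on_linear)

lemma smooth_on_add:
  "open S \<Longrightarrow> smooth_on S f \<Longrightarrow> smooth_on S g \<Longrightarrow> smooth_on S (\<lambda>x. f x + g x)"
  by (simp add: smooth_on_def Ck_on_add)

lemma smooth_on_sum:
  "open S \<Longrightarrow> (\<And>i. i \<in> I \<Longrightarrow> smooth_on S (f i)) \<Longrightarrow> smooth_on S (\<lambda>x. \<Sum>i\<in>I. f i x)"
  by (simp add: smooth_on_def Ck_on_sum)

lemma smooth_on_scaleR:
  "open S \<Longrightarrow> smooth_on S f \<Longrightarrow> smooth_on S g \<Longrightarrow> smooth_on S (\<lambda>x. f x *\<^sub>R g x)"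
  by (simp add: smooth_on_def Ck_on_bilinear[OF _ bounded_bilinear_scaleR])

lemma smooth_on_inner:
  "open S \<Longrightarrow> smooth_on S f \<Longrightarrow> smooth_on S g \<Longrightarrow> smooth_on S (\<lambda>x. f x \<bullet> g x)"
  by (simp add: smooth_on_def Ck_on_bilinear[OF _ bounded_bilinear_inner])

lemma smooth_on_compose:
  fixes f :: "'a::real_normed_vector \<Rightarrow> 'b::euclidean_space"
  shows "open S \<Longrightarrow> smooth_on T g \<Longrightarrow> smooth_on S f \<Longrightarrow> f ` S \<subseteq> T \<Longrightarrow> smooth_on S (\<lambda>x. g (f x))"
  unfolding smooth_on_def using Ck_on_compose by blast

lemma smooth_on_linear_compose:
  fixes f :: "'a::real_normed_vector \<Rightarrow> 'b::euclidean_space"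
  shows "bounded_linear l \<Longrightarrow> open S \<Longrightarrow> smooth_on S f \<Longrightarrow> smooth_on S (\<lambda>x. l (f x))"
  by (rule smooth_on_compose[of _ UNIV]) (auto intro: smooth_on_linear)

lemma smooth_on_Pair:
  fixes f :: "'a::real_normed_vector \<Rightarrow> 'b::euclidean_space" and g :: "'a \<Rightarrow> 'c::euclidean_space"
  assumes "open S" "smooth_on S f" "smooth_on S g"
  shows "smooth_on S (\<lambda>x. (f x, g x))"
proof -
  have "bounded_linear (\<lambda>a. (a, 0::'c))" "bounded_linear (\<lambda>a. (0::'b, a))"
    by (auto intro!: bounded_linear_intros)
  then have "smooth_on S (\<lambda>x. (f x, 0) + (0, g x))"
    using smooth_on_linear_compose[OF _ assms(1), of "\<lambda>a. (a, 0::'c)" f]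
      smooth_on_linear_compose[OF _ assms(1), of "\<lambda>a. (0::'b, a)" g] assms
    by (intro smooth_on_add[OF assms(1)]) blast+
  then show ?thesis by simp
qed

lemma smooth_on_has_derivative:
  "smooth_on S f \<Longrightarrow> x \<in> S \<Longrightarrow> (f has_derivative frechet_derivative f (at x)) (at x)"
  unfolding smooth_on_def using Ck_on_has_derivative by blast

lemma smooth_on_continuous_on: "smooth_on S f \<Longrightarrow> continuous_on S f"
  unfolding smooth_on_def by (metis Ck_on.simps(1))

lemma smooth_on_frechet_derivative:
  "smooth_on S f \<Longrightarrow> smooth_on S (\<lambda>x. frechet_derivative f (at x) v)"
  unfolding smooth_on_def by (metis Ck_on.simps(2))

text \<open>Components of tangent vectors and covectors change between charts by a derivative whose
  base point and argument may both move. Expansion over \<open>Basis\<close> again reduces this to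
  fixed directions.\<close>

lemma smooth_on_derivative_apply:
  fixes f :: "'a::euclidean_space \<Rightarrow> 'b::real_normed_vector"
    and g :: "'c::real_normed_vector \<Rightarrow> 'a"
  assumes "open S" "smooth_on T f" "smooth_on S g" "smooth_on S w" "g ` S \<subseteq> T"
  shows "smooth_on S (\<lambda>x. frechet_derivative f (at (g x)) (w x))"
proof -
  have "smooth_on S (\<lambda>x. \<Sum>i\<in>Basis. (w x \<bullet> i) *\<^sub>R frechet_derivative f (at (g x)) i)"
    using assms by (intro smooth_on_sum smooth_on_scaleR smooth_on_inner smooth_on_const
        smooth_on_compose[OF _ smooth_on_frechet_derivative]) auto
  moreover have "linear (frechet_derivative f (at (g x)))" if "x \<in> S" for x
    using smooth_on_has_derivative[OF assms(2)] assms(5) that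
    by (meson bounded_linear.linear has_derivative_bounded_linear image_subset_iff)
  ultimately show ?thesis
    by (elim smooth_on_cong[OF _ assms(1)]) (rule linear_Basis_expand)
qed

subsection \<open>Linear differential equations\<close>

text \<open>Picard iteration; \<open>N i\<close> is the i-th row of the coefficient matrix. The
  integral operator is a contraction of the complete space of bounded continuous functions on the
  real line, once the time interval is short.\<close>

lemma linear_ode_exists:
  fixes N :: "'a::euclidean_space \<Rightarrow> real \<Rightarrow> 'a" and p0 :: 'a
  assumes "open I" "0 \<in> I" and cont: "\<And>i. i \<in> Basis \<Longrightarrow> continuous_on I (N i)"
  obtains e p where "0 < e" "{-e<..<e} \<subseteq> I" "p 0 = p0"
    "\<And>s. s \<in> {-e<..<e} \<Longrightarrow>
       (p has_vector_derivative (\<Sum>i\<in>Basis. (p s \<bullet> N i s) *\<^sub>R i)) (at s)"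
proof -
  obtain r where r: "r > 0" "cball 0 r \<subseteq> I"
    using assms open_contains_cball by blast
  have rI: "{-r..r} \<subseteq> I" using r(2) by (auto simp: subset_iff dist_real_def)
  have "\<exists>B. \<forall>s\<in>{-r..r}. norm (N i s) \<le> B" if "i \<in> Basis" for i
  proof -
    have "compact (N i ` {-r..r})"
      using cont[OF that] rI by (intro compact_continuous_image continuous_on_subset[OF _ rI]) auto
    then show ?thesis using compact_imp_bounded bounded_iff by (metis imageI)
  qed
  then obtain B where B: "\<And>i s. i \<in> Basis \<Longrightarrow> s \<in> {-r..r} \<Longrightarrow> norm (N i s) \<le> B i" by metis
  \<comment> \<open>The summand 1 makes \<open>C\<close> positive even if all bounds vanish, so that
    it can be divided by.\<close>
  define C where "C = (\<Sum>i\<in>(Basis::'a set). \<bar>B i\<bar>) + 1"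
  have C: "C > 0" unfolding C_def by (smt (verit) sum_nonneg abs_ge_zero)
  define M where "M = (\<lambda>s (v::'a). \<Sum>i\<in>Basis. (v \<bullet> N i s) *\<^sub>R i)"
  have M_diff: "M s v - M s w = M s (v - w)" for s v w
    unfolding M_def by (simp add: inner_diff_left scaleR_diff_left sum_subtractf)
  have M_bound: "norm (M s v) \<le> C * norm v" if "s \<in> {-r..r}" for s v
  proof -
    have "norm (M s v) \<le> (\<Sum>i\<in>(Basis::'a set). \<bar>v \<bullet> N i s\<bar>)"
      unfolding M_def by (rule order_trans[OF norm_sum]) simp
    also have "\<dots> \<le> (\<Sum>i\<in>(Basis::'a set). norm v * \<bar>B i\<bar>)"
      using B that by (intro sum_mono order_trans[OF Cauchy_Schwarz_ineq2] mult_left_mono)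
        (auto intro: order_trans[OF _ abs_ge_self])
    also have "\<dots> \<le> C * norm v"
      unfolding C_def by (simp add: sum_distrib_left[symmetric] algebra_simps)
    finally show ?thesis .
  qed
  have M_cont: "continuous_on {-r..r} (\<lambda>t. M t (f t))" if "continuous_on {-r..r} f" for f
    unfolding M_def using that by (intro continuous_intros continuous_on_subset[OF cont rI])
  \<comment> \<open>The contraction estimate involves two integrals, each over a length of at most
    2e, so the Lipschitz constant is \<open>4 * e * C\<close>; the factor 8 brings it down to
    1/2.\<close>
  define e where "e = min r (1 / (8 * C))"
  have e: "e > 0" "e \<le> r" "4 * e * C \<le> 1/2"
    using r C unfolding e_def by (auto simp: field_simps min_def)
  have sub: "{-e..e} \<subseteq> {-r..r}" using e by auto
  note M_cont_e = continuous_on_subset[OF M_cont sub]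
  \<comment> \<open>Integrating from -e treats negative and positive times by one formula; the
    operator subtracts \<open>G p 0\<close> to put the initial condition at time 0.\<close>
  define G where "G = (\<lambda>(p::real \<Rightarrow> 'a) s. integral {-e..s} (\<lambda>t. M t (p t)))"
  have G_der: "((G p) has_vector_derivative M s (p s)) (at s within {-e..e})"
    if "continuous_on UNIV p" "s \<in> {-e..e}" for p s
    unfolding G_def
    using that by (intro integral_has_vector_derivative M_cont_e) (auto intro: continuous_on_subset)
  have G_diff: "norm (G p s - G q s) \<le> 2 * e * C * K"
    if "continuous_on UNIV p" "continuous_on UNIV q" "s \<in> {-e..e}" and K: "\<And>t. norm (p t - q t) \<le> K" for p q s K
  proof -
    have K0: "K \<ge> 0" using K[of 0] norm_ge_zero order_trans by blast
    have c: "continuous_on {-e..s} (\<lambda>t. M t (p t))" "continuous_on {-e..s} (\<lambda>t. M t (q t))"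
      using that e by (auto intro!: continuous_on_subset[OF M_cont] intro: continuous_on_subset)
    have "G p s - G q s = integral {-e..s} (\<lambda>t. M t (p t) - M t (q t))"
      unfolding G_def using c by (intro integral_diff[symmetric] integrable_continuous_real)
    also have "norm \<dots> \<le> C * K * (s - (-e))"
    proof (rule integral_bound)
      show "norm (M t (p t) - M t (q t)) \<le> C * K" if "t \<in> {-e..s}" for t
        unfolding M_diff using M_bound[of t "p t - q t"] K[of t] C that \<open>s \<in> {-e..e}\<close> sub
        by (auto intro!: order_trans[OF M_bound] mult_left_mono)
    qed (use that c in \<open>auto intro: continuous_intros\<close>)
    also have "\<dots> \<le> C * K * (2 * e)"
      using that C K0 by (intro mult_left_mono) auto
    finally show ?thesis by (simp add: algebra_simps)
  qed
  \<comment> \<open>Freezing time outside [-e, e] makes every image of the operator bounded and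
    continuous on the whole line, without changing it on the interval.\<close>
  define cl where "cl = (\<lambda>s. max (-e) (min e s))"
  have cl: "cl s \<in> {-e..e}" "continuous_on UNIV cl" for s
    using e unfolding cl_def by (auto intro!: continuous_intros)
  have cl_id: "cl s = s" if "s \<in> {-e..e}" for s using that unfolding cl_def by auto
  define T where "T = (\<lambda>p::real \<Rightarrow>\<^sub>C 'a. \<lambda>s. p0 + (G p (cl s) - G p 0))"
  have G_cont: "continuous_on {-e..e} (G p)" if "continuous_on UNIV p" for p
    using G_der[OF that] by (meson has_vector_derivative_continuous continuous_on_eq_continuous_within)
  have T: "T p \<in> bcontfun" for p
  proof -
    have c: "continuous_on {-e..e} (G p)" by (rule G_cont) simp
    have "continuous_on UNIV (T p)"
      unfolding T_def using cl by (intro continuous_intros continuous_on_compose2[OF c]) auto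
    moreover have "bounded (range (T p))"
    proof -
      have "compact ((\<lambda>s. p0 + (G p s - G p 0)) ` {-e..e})"
        using c by (intro compact_continuous_image continuous_intros) auto
      moreover have "range (T p) \<subseteq> (\<lambda>s. p0 + (G p s - G p 0)) ` {-e..e}"
        unfolding T_def using cl by auto
      ultimately show ?thesis using bounded_subset compact_imp_bounded by blast
    qed
    ultimately show ?thesis by (simp add: bcontfun_def)
  qed
  define \<Phi> where "\<Phi> = (\<lambda>p. Bcontfun (T p))"
  have \<Phi>: "apply_bcontfun (\<Phi> p) = T p" for p
    unfolding \<Phi>_def using T by (simp add: Bcontfun_inverse)
  have contr: "dist (\<Phi> p) (\<Phi> q) \<le> 1/2 * dist p q" for p q
  proof (rule dist_bound)
    fix s
    have K: "norm (apply_bcontfun p t - apply_bcontfun q t) \<le> dist p q" for t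
      using dist_bounded[of p t q] by (simp add: dist_norm)
    have "norm (G p (cl s) - G q (cl s)) \<le> 2 * e * C * dist p q"
      "norm (G p 0 - G q 0) \<le> 2 * e * C * dist p q"
      using cl e by (auto intro!: G_diff K)
    then have "norm ((G p (cl s) - G q (cl s)) - (G p 0 - G q 0)) \<le> 4 * e * C * dist p q"
      by (intro order_trans[OF norm_triangle_ineq4]) linarith
    also have "\<dots> \<le> 1/2 * dist p q" using e(3) by (intro mult_right_mono) auto
    finally show "dist (apply_bcontfun (\<Phi> p) s) (apply_bcontfun (\<Phi> q) s) \<le> 1/2 * dist p q"
      by (simp add: \<Phi> T_def dist_norm algebra_simps)
  qed
  obtain p where p: "\<Phi> p = p"
    using banach_fix_type[of "1/2" \<Phi>] contr by auto
  have pT: "apply_bcontfun p s = p0 + (G p (cl s) - G p 0)" for s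
    using \<Phi>[of p] p by (simp add: T_def fun_eq_iff)
  show thesis
  proof
    show "{-e<..<e} \<subseteq> I" using sub rI by auto
    show "apply_bcontfun p 0 = p0" using pT[of 0] cl_id[of 0] e by simp
    show "(apply_bcontfun p has_vector_derivative (\<Sum>i\<in>Basis. (apply_bcontfun p s \<bullet> N i s) *\<^sub>R i)) (at s)"
      if s: "s \<in> {-e<..<e}" for s
    proof -
      have "((G p) has_vector_derivative M s (p s)) (at s within {-e<..<e})"
        using G_der[of p s] s by (auto intro: has_vector_derivative_within_subset)
      then have "((G p) has_vector_derivative M s (p s)) (at s)"
        using s at_within_open[of s "{-e<..<e}"] by auto
      then have "((\<lambda>s. p0 + (G p s - G p 0)) has_vector_derivative M s (p s)) (at s)"
        by (auto intro!: derivative_eq_intros)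
      then show ?thesis unfolding M_def
        by (rule has_vector_derivative_transform_within_open[where S="{-e<..<e}"])
          (use s in \<open>auto simp: pT cl_id\<close>)
    qed
  qed (use e in auto)
qed

text \<open>Bootstrapping: the right-hand side of the equation is as regular as \<open>p\<close>, so
  each order of differentiability of \<open>p\<close> yields the next.\<close>

lemma linear_ode_smooth:
  fixes N :: "'a::euclidean_space \<Rightarrow> real \<Rightarrow> 'a" and p :: "real \<Rightarrow> 'a"
  assumes "open I" "\<And>i. i \<in> Basis \<Longrightarrow> smooth_on I (N i)"
    and p: "\<And>s. s \<in> I \<Longrightarrow> (p has_vector_derivative (\<Sum>i\<in>Basis. (p s \<bullet> N i s) *\<^sub>R i)) (at s)"
  shows "smooth_on I p"
proof -
  have "Ck_on k I p" for k
  proof (induction k)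
    case 0
    show ?case
      using p by (auto simp: continuous_on_eq_continuous_within
          intro!: has_vector_derivative_continuous intro: has_vector_derivative_at_within)
  next
    case (Suc k)
    note d = p[unfolded has_vector_derivative_def]
    show ?case
      using assms(2) Suc
      by (intro Ck_on_SucI[OF assms(1) d] Ck_on_bilinear[OF assms(1) bounded_bilinear_scaleR]
          Ck_on_bilinear[OF assms(1) bounded_bilinear_inner] Ck_on_sum assms(1) Ck_on_const)
        (auto simp: smooth_on_def)
  qed
  then show ?thesis by (simp add: smooth_on_def)
qed

subsection \<open>Charts and tangent spaces\<close>

locale smooth_atlas =
  fixes A :: "('q, 'e::euclidean_space) chart set"
  assumes M: "smooth_manifold A"
begin

lemma chart_inv_coord: "c \<in> A \<Longrightarrow> q \<in> fst c \<Longrightarrow> chart_inv c (snd c q) = q"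
  using M unfolding smooth_manifold_def chart_inv_def by (simp add: inv_into_f_f)

lemma coord_chart_inv: "y \<in> snd c ` fst c \<Longrightarrow> snd c (chart_inv c y) = y"
  unfolding chart_inv_def by (rule f_inv_into_f)

lemma chart_inv_in: "y \<in> snd c ` fst c \<Longrightarrow> chart_inv c y \<in> fst c"
  unfolding chart_inv_def by (rule inv_into_into)

lemma inj_chart: "c \<in> A \<Longrightarrow> inj_on (snd c) (fst c)"
  using M unfolding smooth_manifold_def by blast

lemma open_chart_image: "c \<in> A \<Longrightarrow> open (snd c ` fst c)"
  using M unfolding smooth_manifold_def by blast

lemma open_overlap: "c \<in> A \<Longrightarrow> d \<in> A \<Longrightarrow> open (snd c ` (fst c \<inter> fst d))"
  using M unfolding smooth_manifold_def by blast

lemma smooth_transition: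
  "c \<in> A \<Longrightarrow> d \<in> A \<Longrightarrow> smooth_on (snd c ` (fst c \<inter> fst d)) (transition c d)"
  using M unfolding smooth_manifold_def by blast

lemma transition_coord: "c \<in> A \<Longrightarrow> q \<in> fst c \<Longrightarrow> transition c d (snd c q) = snd d q"
  unfolding transition_def by (simp add: chart_inv_coord)

lemma transition_chart_inv: "snd d (chart_inv c y) = transition c d y"
  unfolding transition_def by simp

lemma image_chart_Int:
  "c \<in> A \<Longrightarrow> y \<in> snd c ` (fst c \<inter> U) \<longleftrightarrow> y \<in> snd c ` fst c \<and> chart_inv c y \<in> U"
  using chart_inv_coord coord_chart_inv chart_inv_in
  by (smt (verit) IntE IntI image_iff)

abbreviation "D c d q \<equiv> frechet_derivative (transition c d) (at (snd c q))"

lemma transition_has_derivative: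
  assumes "c \<in> A" "d \<in> A" "q \<in> fst c" "q \<in> fst d"
  shows "(transition c d has_derivative D c d q) (at (snd c q))"
  using smooth_on_has_derivative[OF smooth_transition] assms by blast

lemma linear_D:
  assumes "c \<in> A" "d \<in> A" "q \<in> fst c" "q \<in> fst d"
  shows "linear (D c d q)"
  using transition_has_derivative[OF assms] has_derivative_linear by blast

text \<open>Cocycle identity of the Jacobians, by the chain rule on the overlap. It makes the family
  built by \<open>tangent_of\<close> satisfy the transformation law in
  \<open>tangent_space\<close>.\<close>

lemma D_comp:
  assumes "c \<in> A" "d \<in> A" "k \<in> A" "q \<in> fst c" "q \<in> fst d" "q \<in> fst k"
  shows "D d k q (D c d q v) = D c k q v"
proof -
  have "(transition d k \<circ> transition c d has_derivative D d k q \<circ> D c d q) (at (snd c q))"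
    using transition_has_derivative[of d k q] transition_has_derivative[of c d q] assms
    by (intro diff_chain_at) (simp_all add: transition_coord)
  then have "(transition c k has_derivative D d k q \<circ> D c d q) (at (snd c q))"
    by (rule has_derivative_transform_within_open[OF _ open_overlap[OF assms(1,2)]])
      (use assms in \<open>auto simp: transition_coord\<close>)
  then show ?thesis
    by (metis comp_apply frechet_derivative_at)
qed

lemma D_self:
  assumes "c \<in> A" "q \<in> fst c"
  shows "D c c q v = v"
proof -
  have "(transition c c has_derivative id) (at (snd c q))"
    by (rule has_derivative_transform_within_open[OF has_derivative_id open_chart_image[OF assms(1)]])
      (use assms in \<open>auto simp: transition_coord\<close>)
  then show ?thesis by (metis frechet_derivative_at id_apply)
qed

lemma tangent_of_eq: "d \<in> A \<Longrightarrow> q \<in> fst d \<Longrightarrow> tangent_of A c q x d = D c d q x"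
  by (simp add: tangent_of_def)

lemma tangent_of_self: "c \<in> A \<Longrightarrow> q \<in> fst c \<Longrightarrow> tangent_of A c q x c = x"
  by (simp add: tangent_of_eq D_self)

lemma tangent_of_in: "c \<in> A \<Longrightarrow> q \<in> fst c \<Longrightarrow> tangent_of A c q x \<in> tangent_space A q"
  unfolding tangent_space_def by (simp add: tangent_of_eq D_comp) (simp add: tangent_of_def)

text \<open>With \<open>tangent_of_self\<close> this identifies the tangent space with the model
  space by the component in a single chart. At indices that are not charts around \<open>q\<close>
  both sides are 0 by convention.\<close>

lemma tangent_of_component:
  assumes "c \<in> A" "q \<in> fst c" "v \<in> tangent_space A q"
  shows "tangent_of A c q (v c) = v"
proof
  fix d
  show "tangent_of A c q (v c) d = v d"
  proof (cases "d \<in> A \<and> q \<in> fst d")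
    case True
    then have "v d = D c d q (v c)" using assms unfolding tangent_space_def by blast
    then show ?thesis using True by (simp only: tangent_of_eq)
  next
    case False
    then have "v d = 0" using assms unfolding tangent_space_def by blast
    then show ?thesis using False by (auto simp: tangent_of_def)
  qed
qed

lemma tangent_space_eqI:
  assumes "c \<in> A" "q \<in> fst c" "v \<in> tangent_space A q" "w \<in> tangent_space A q" "v c = w c"
  shows "v = w"
  using tangent_of_component assms by metis

lemma tangent_space_component:
  assumes "c \<in> A" "q \<in> fst c" "d \<in> A" "q \<in> fst d" "v \<in> tangent_space A q"
  shows "v d = D c d q (v c)"
  using tangent_of_component assms by (metis tangent_of_eq)

lemma linear_tangent_of: "c \<in> A \<Longrightarrow> q \<in> fst c \<Longrightarrow> linear (tangent_of A c q)"
  by (rule linearI; rule ext)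
    (auto simp: tangent_of_def plus_fun_def scaleR_fun_def linear_add[OF linear_D] linear_cmul[OF linear_D])

lemma tangent_space_add_scaleR:
  assumes "c \<in> A" "q \<in> fst c" "v \<in> tangent_space A q" "w \<in> tangent_space A q"
  shows "a *\<^sub>R v + b *\<^sub>R w \<in> tangent_space A q"
proof -
  note l = linear_tangent_of[OF assms(1,2)]
  have "a *\<^sub>R v + b *\<^sub>R w = tangent_of A c q (a *\<^sub>R v c + b *\<^sub>R w c)"
    using tangent_of_component[OF assms(1,2)] assms by (simp add: linear_add[OF l] linear_cmul[OF l])
  then show ?thesis using tangent_of_in assms by simp
qed

lemma subspace_tangent_space: "c \<in> A \<Longrightarrow> q \<in> fst c \<Longrightarrow> subspace (tangent_space A q)"
  unfolding subspace_def
  using tangent_space_add_scaleR[where a=1 and b=1] tangent_space_add_scaleR[where b=0]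
    tangent_of_in[of c q 0] linear_0[OF linear_tangent_of]
  by simp

lemma chart_at: "q \<in> points A \<Longrightarrow> chart_at A q \<in> A \<and> q \<in> fst (chart_at A q)"
  unfolding chart_at_def points_def by (rule someI_ex) auto

lemma in_points: "c \<in> A \<Longrightarrow> q \<in> fst c \<Longrightarrow> q \<in> points A"
  unfolding points_def by blast

text \<open>The definition evaluates in a chosen chart. The chain rule through the transition map
  compensates the change of the component of \<open>v\<close>, so every chart gives the same
  value.\<close>

lemma differential_in_chart:
  assumes "c \<in> A" "q \<in> fst c" "v \<in> tangent_space A q"
    and f: "((f \<circ> chart_inv c) has_derivative f') (at (snd c q))"
  shows "pairing (differential A f q) (q, v) = f' (v c)"
proof -
  obtain d where d: "d = chart_at A q" "d \<in> A" "q \<in> fst d"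
    using chart_at assms in_points by blast
  have "((f \<circ> chart_inv c) \<circ> transition d c has_derivative f' \<circ> D d c q) (at (snd d q))"
    using f d assms
    by (intro diff_chain_at transition_has_derivative) (simp_all add: transition_coord)
  then have "((f \<circ> chart_inv d) has_derivative f' \<circ> D d c q) (at (snd d q))"
    by (rule has_derivative_transform_within_open[OF _ open_overlap[OF d(2) assms(1)]])
      (use assms d in \<open>auto simp: transition_coord chart_inv_coord\<close>)
  then have "frechet_derivative (f \<circ> chart_inv d) (at (snd d q)) = f' \<circ> D d c q"
    by (metis frechet_derivative_at)
  then show ?thesis
    using tangent_space_component[OF d(2,3) assms(1,2,3)] assms(3)
    by (simp only: differential_def pairing_def Let_def d(1) snd_conv if_True comp_apply)
qed

subsection \<open>Covectors in coordinates\<close>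

text \<open>Inverse of \<open>comps\<close>, the momentum part of the cotangent chart. The value 0
  off the tangent space is the normalisation imposed by \<open>cotangent_space\<close>, so that
  covectors with equal components are equal as functions.\<close>

definition covec :: "('q, 'e) chart \<Rightarrow> 'q \<Rightarrow> 'e \<Rightarrow> ('q, 'e) cvec"
  where "covec c q p = (\<lambda>v. if v \<in> tangent_space A q then p \<bullet> v c else 0)"

definition comps :: "('q, 'e) chart \<Rightarrow> 'q \<Rightarrow> ('q, 'e) cvec \<Rightarrow> 'e"
  where "comps c q \<alpha> = (\<Sum>i\<in>Basis. \<alpha> (tangent_of A c q i) *\<^sub>R i)"

lemma covec_in: "c \<in> A \<Longrightarrow> q \<in> fst c \<Longrightarrow> covec c q p \<in> cotangent_space A q"
  unfolding cotangent_space_def covec_def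
  by (simp add: tangent_space_add_scaleR inner_add_right) (simp add: scaleR_fun_def)

lemma covec_tangent_of: "c \<in> A \<Longrightarrow> q \<in> fst c \<Longrightarrow> covec c q p (tangent_of A c q x) = p \<bullet> x"
  by (simp add: covec_def tangent_of_in tangent_of_self)

lemma comps_covec: "c \<in> A \<Longrightarrow> q \<in> fst c \<Longrightarrow> comps c q (covec c q p) = p"
  by (simp add: comps_def covec_tangent_of euclidean_representation)

lemma cotangent_space_linear:
  assumes "\<alpha> \<in> cotangent_space A q" "v \<in> tangent_space A q" "w \<in> tangent_space A q"
  shows "\<alpha> (a *\<^sub>R v + b *\<^sub>R w) = a * \<alpha> v + b * \<alpha> w"
  using assms unfolding cotangent_space_def by blast

lemma cotangent_space_scaleR:
  assumes "\<alpha> \<in> cotangent_space A q" "v \<in> tangent_space A q"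
  shows "\<alpha> (a *\<^sub>R v) = a * \<alpha> v"
  using cotangent_space_linear[OF assms assms(2), of a 0] by simp

lemma covector_eq:
  assumes "c \<in> A" "q \<in> fst c" "\<alpha> \<in> cotangent_space A q" "v \<in> tangent_space A q"
  shows "\<alpha> v = comps c q \<alpha> \<bullet> v c"
proof -
  note l = linear_tangent_of[OF assms(1,2)]
  have "linear (\<lambda>x. \<alpha> (tangent_of A c q x))"
    using cotangent_space_linear[OF assms(3) tangent_of_in tangent_of_in, of c c, where a=1 and b=1]
      cotangent_space_scaleR[OF assms(3) tangent_of_in] assms
    by (intro linearI) (simp_all add: linear_add[OF l] linear_cmul[OF l])
  from linear_Basis_expand[OF this, of "v c"] show ?thesis
    using tangent_of_component assms
    by (simp add: comps_def inner_sum_left inner_sum_right inner_commute mult.commute)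
qed

lemma covec_comps:
  assumes "c \<in> A" "q \<in> fst c" "\<alpha> \<in> cotangent_space A q"
  shows "covec c q (comps c q \<alpha>) = \<alpha>"
proof
  fix v
  show "covec c q (comps c q \<alpha>) v = \<alpha> v"
    using covector_eq[OF assms] assms(3) unfolding covec_def cotangent_space_def by auto
qed

lemma comps_add_scaleR:
  "comps c q (\<alpha> + s *\<^sub>R \<beta>) = comps c q \<alpha> + s *\<^sub>R comps c q \<beta>"
  by (simp add: comps_def plus_fun_def scaleR_fun_def scaleR_add_left sum.distrib scaleR_sum_right)

lemma cotangent_space_add_scaleR:
  assumes "\<alpha> \<in> cotangent_space A q" "\<beta> \<in> cotangent_space A q"
  shows "\<alpha> + s *\<^sub>R \<beta> \<in> cotangent_space A q"
  using assms unfolding cotangent_space_def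
  by (auto simp: plus_fun_def scaleR_fun_def algebra_simps)

lemma fst_cotangent_chart: "fst (cotangent_chart A c) = Sigma (fst c) (cotangent_space A)"
  by (simp add: cotangent_chart_def)

lemma snd_cotangent_chart: "snd (cotangent_chart A c) z = (snd c (fst z), comps c (fst z) (snd z))"
  by (simp add: cotangent_chart_def comps_def case_prod_beta)

lemma inj_cotangent_chart:
  assumes "c \<in> A" shows "inj_on (snd (cotangent_chart A c)) (fst (cotangent_chart A c))"
proof (rule inj_onI)
  fix z w assume z: "z \<in> fst (cotangent_chart A c)" and w: "w \<in> fst (cotangent_chart A c)"
    and eq: "snd (cotangent_chart A c) z = snd (cotangent_chart A c) w"
  then have "fst z = fst w"
    using inj_chart[OF assms] by (auto simp: snd_cotangent_chart fst_cotangent_chart inj_on_def)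
  moreover have "snd z = snd w"
  proof -
    have "covec c (fst z) (comps c (fst z) (snd z)) = snd z"
      using z by (intro covec_comps[OF assms]) (auto simp: fst_cotangent_chart)
    moreover have "covec c (fst w) (comps c (fst w) (snd w)) = snd w"
      using w by (intro covec_comps[OF assms]) (auto simp: fst_cotangent_chart)
    moreover have "comps c (fst z) (snd z) = comps c (fst w) (snd w)"
      using eq by (simp add: snd_cotangent_chart)
    ultimately show ?thesis using \<open>fst z = fst w\<close> by metis
  qed
  ultimately show "z = w" by (simp add: prod_eq_iff)
qed

lemma chart_inv_cotangent:
  assumes "c \<in> A" "y \<in> snd c ` fst c"
  shows "chart_inv (cotangent_chart A c) (y, p) = (chart_inv c y, covec c (chart_inv c y) p)"
proof -
  have i: "chart_inv c y \<in> fst c" by (rule chart_inv_in[OF assms(2)])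
  let ?z = "(chart_inv c y, covec c (chart_inv c y) p)"
  have "?z \<in> fst (cotangent_chart A c)"
    using i covec_in assms by (simp add: fst_cotangent_chart)
  moreover have "snd (cotangent_chart A c) ?z = (y, p)"
    using i assms by (simp add: snd_cotangent_chart coord_chart_inv comps_covec)
  ultimately show ?thesis
    unfolding chart_inv_def[of "cotangent_chart A c"]
    using inj_cotangent_chart[OF assms(1)] by (metis inv_into_f_f)
qed

lemma chart_inv_cotangent_coord:
  assumes "c \<in> A" "q \<in> fst c" "\<alpha> \<in> cotangent_space A q"
  shows "chart_inv (cotangent_chart A c) (snd c q, comps c q \<alpha>) = (q, \<alpha>)"
  using assms by (simp add: chart_inv_cotangent chart_inv_coord covec_comps)

subsection \<open>Open sets and smooth maps\<close>

lemma openin_chart_preimage: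
  "c \<in> A \<Longrightarrow> open V \<Longrightarrow> openin (atlas_topology A) {x \<in> fst c. snd c x \<in> V}"
  unfolding atlas_topology_def by (rule topology_generated_by_Basis) blast

lemma openin_chart: "c \<in> A \<Longrightarrow> openin (atlas_topology A) (fst c)"
  using openin_chart_preimage[of c UNIV] by simp

lemma openin_subset_points: "openin (atlas_topology A) U \<Longrightarrow> U \<subseteq> points A"
  using openin_subset[of "atlas_topology A" U]
  unfolding atlas_topology_def points_def topology_generated_by_topspace by blast

text \<open>Induction over the generation of the topology. Intersections need injectivity of the
  chart; for a generating set from another chart the image is the preimage of an open set under a
  continuous transition map.\<close>

lemma open_chart_image_Int:
  assumes "c \<in> A" "openin (atlas_topology A) U"
  shows "open (snd c ` (fst c \<inter> U))"
proof -
  have "generate_topology_on {{x \<in> fst c. snd c x \<in> V} | c V. c \<in> A \<and> open V} U"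
    using assms(2) unfolding atlas_topology_def by (rule openin_topology_generated_by)
  then show ?thesis
  proof induction
    case Empty
    then show ?case by simp
  next
    case (Int a b)
    have "snd c ` (fst c \<inter> (a \<inter> b)) = snd c ` (fst c \<inter> a) \<inter> snd c ` (fst c \<inter> b)"
      using inj_chart[OF assms(1)] by (auto simp: inj_on_def)
    then show ?case using Int by auto
  next
    case (UN K)
    have "snd c ` (fst c \<inter> \<Union> K) = (\<Union>k\<in>K. snd c ` (fst c \<inter> k))" by blast
    then show ?case using UN by auto
  next
    case (Basis s)
    then obtain d V where d: "d \<in> A" "open V" "s = {x \<in> fst d. snd d x \<in> V}" by blast
    let ?O = "snd c ` (fst c \<inter> fst d)"
    have "snd c ` (fst c \<inter> s) = {y \<in> ?O. transition c d y \<in> V}"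
      using assms(1) d by (auto simp: transition_coord)
    moreover have "open {y \<in> ?O. transition c d y \<in> V}"
      using smooth_on_continuous_on[OF smooth_transition[OF assms(1) d(1)]]
        open_overlap[OF assms(1) d(1)] d(2)
      by (metis continuous_on_open_vimage open_Int vimage_def Collect_conj_eq Collect_mem_eq Int_def
          mem_Collect_eq Int_commute)
    ultimately show ?case by simp
  qed
qed

lemma smooth_fun_on_iff:
  "smooth_fun_on A U f \<longleftrightarrow> openin (atlas_topology A) U \<and>
    (\<forall>c\<in>A. smooth_on (snd c ` (fst c \<inter> U)) (f \<circ> chart_inv c))"
  unfolding smooth_fun_on_def smooth_map_on_def Let_def euclidean_atlas_def points_def
  using open_chart_image_Int by (auto simp: Int_def)

text \<open>Smoothness of the section is tested in all pairs of a chart of the base and a chart of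
  the tangent bundle. The pairs coming from the same chart suffice, since the others arise from them
  by the transition map and its derivative.\<close>

lemma vector_field_on_iff:
  "vector_field_on A U X \<longleftrightarrow> openin (atlas_topology A) U \<and> (\<forall>q\<in>U. X q \<in> tangent_space A q) \<and>
    (\<forall>c\<in>A. smooth_on (snd c ` (fst c \<inter> U)) (\<lambda>y. X (chart_inv c y) c))"
proof (intro iffI conjI ballI)
  assume *: "vector_field_on A U X"
  then show o: "openin (atlas_topology A) U"
    unfolding vector_field_on_def smooth_map_on_def by blast
  have "(\<lambda>q. (q, X q)) ` U \<subseteq> points (tangent_atlas A)"
    using * unfolding vector_field_on_def smooth_map_on_def by blast
  then show t: "X q \<in> tangent_space A q" if "q \<in> U" for q
    using that unfolding points_def tangent_atlas_def by auto
  fix c assume c: "c \<in> A"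
  let ?d = "(Sigma (fst c) (tangent_space A), \<lambda>(q, v::('q, 'e) tvec). (snd c q, v c))"
  have dA: "?d \<in> tangent_atlas A" using c unfolding tangent_atlas_def by blast
  have eq: "{x \<in> fst c \<inter> U. (x, X x) \<in> fst ?d} = fst c \<inter> U" using t by auto
  have "\<forall>d\<in>tangent_atlas A. smooth_on (snd c ` {x \<in> fst c \<inter> U. (x, X x) \<in> fst d})
      (snd d \<circ> (\<lambda>q. (q, X q)) \<circ> chart_inv c)"
    using * c unfolding vector_field_on_def smooth_map_on_def Let_def by blast
  from bspec[OF this dA] have "smooth_on (snd c ` (fst c \<inter> U)) (snd ?d \<circ> (\<lambda>q. (q, X q)) \<circ> chart_inv c)"
    unfolding eq .
  then have "smooth_on (snd c ` (fst c \<inter> U)) (\<lambda>y. snd ((snd ?d \<circ> (\<lambda>q. (q, X q)) \<circ> chart_inv c) y))"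
    by (intro smooth_on_linear_compose[OF bounded_linear_snd] open_chart_image_Int c o)
  then show "smooth_on (snd c ` (fst c \<inter> U)) (\<lambda>y. X (chart_inv c y) c)" by simp
next
  assume *: "openin (atlas_topology A) U \<and> (\<forall>q\<in>U. X q \<in> tangent_space A q) \<and>
    (\<forall>c\<in>A. smooth_on (snd c ` (fst c \<inter> U)) (\<lambda>y. X (chart_inv c y) c))"
  show "vector_field_on A U X"
    unfolding vector_field_on_def smooth_map_on_def Let_def
  proof (intro conjI ballI)
    show "openin (atlas_topology A) U" using * by blast
    show "(\<lambda>q. (q, X q)) ` U \<subseteq> points (tangent_atlas A)"
      using * openin_subset_points[of U] unfolding points_def tangent_atlas_def by fastforce
    fix c e assume c: "c \<in> A" and "e \<in> tangent_atlas A"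
    then obtain d where d: "d \<in> A" and
      e: "e = (Sigma (fst d) (tangent_space A), \<lambda>(q, v). (snd d q, v d))"
      unfolding tangent_atlas_def by blast
    have eq: "{x \<in> fst c \<inter> U. (x, X x) \<in> fst e} = fst c \<inter> (fst d \<inter> U)"
      using * e by auto
    let ?S = "snd c ` (fst c \<inter> (fst d \<inter> U))"
    have "openin (atlas_topology A) (fst d \<inter> U)"
      using * openin_chart d by blast
    then have o: "open ?S" using open_chart_image_Int c by blast
    then show "open (snd c ` {x \<in> fst c \<inter> U. (x, X x) \<in> fst e})" by (simp only: eq)
    have s: "smooth_on ?S (transition c d)"
      by (rule smooth_on_subset[OF smooth_transition[OF c d]]) blast
    have s2: "smooth_on ?S (\<lambda>y. X (chart_inv c y) c)"
      using * c smooth_on_subset by (metis (no_types, lifting) Int_lower2 Int_mono image_mono subset_refl)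
    have "smooth_on ?S (\<lambda>y. frechet_derivative (transition c d) (at y) (X (chart_inv c y) c))"
      by (intro smooth_on_derivative_apply[OF o s _ s2] smooth_on_linear o bounded_linear_ident) auto
    then have "smooth_on ?S (\<lambda>y. (transition c d y, frechet_derivative (transition c d) (at y) (X (chart_inv c y) c)))"
      by (intro smooth_on_Pair o s)
    then have "smooth_on ?S (snd e \<circ> (\<lambda>q. (q, X q)) \<circ> chart_inv c)"
      by (rule smooth_on_cong[OF _ o])
        (use c d * in \<open>auto simp: e chart_inv_coord transition_coord tangent_space_component[of c _ d]\<close>)
    then show "smooth_on (snd c ` {x \<in> fst c \<inter> U. (x, X x) \<in> fst e}) (snd e \<circ> (\<lambda>q. (q, X q)) \<circ> chart_inv c)"
      by (simp only: eq)
  qed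
qed

subsection \<open>Vector fields in coordinates\<close>

abbreviation coord_field :: "('q, 'e) chart \<Rightarrow> 'e \<Rightarrow> 'q \<Rightarrow> ('q, 'e) tvec"
  where "coord_field c w \<equiv> \<lambda>q. tangent_of A c q w"

lemma vector_field_coord_field:
  assumes c: "c \<in> A"
  shows "vector_field_on A (fst c) (coord_field c w)"
  unfolding vector_field_on_iff
proof (intro conjI ballI)
  fix d assume d: "d \<in> A"
  let ?S = "snd d ` (fst d \<inter> fst c)"
  have o: "open ?S" by (rule open_overlap[OF d c])
  have "smooth_on ?S (\<lambda>y. frechet_derivative (transition c d) (at (transition d c y)) w)"
    by (rule smooth_on_derivative_apply[OF o smooth_transition[OF c d] smooth_transition[OF d c]])
      (use c d in \<open>auto simp: transition_coord intro: smooth_on_const o\<close>)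
  then show "smooth_on ?S (\<lambda>y. tangent_of A c (chart_inv d y) w d)"
    by (rule smooth_on_cong[OF _ o])
      (use c d in \<open>auto simp: tangent_of_eq chart_inv_coord transition_coord\<close>)
qed (use c in \<open>auto simp: tangent_of_in openin_chart\<close>)

lemma vector_field_on_restrict:
  assumes "vector_field_on A U X" "openin (atlas_topology A) V"
  shows "vector_field_on A (U \<inter> V) X"
  using assms unfolding vector_field_on_iff by (auto intro: smooth_on_subset)

lemma vector_field_on_tangent: "vector_field_on A U X \<Longrightarrow> q \<in> U \<Longrightarrow> X q \<in> tangent_space A q"
  unfolding vector_field_on_iff by blast

lemma vector_field_on_openin: "vector_field_on A U X \<Longrightarrow> openin (atlas_topology A) U"
  unfolding vector_field_on_iff by blast

lemma vector_field_on_points: "vector_field_on A U X \<Longrightarrow> q \<in> U \<Longrightarrow> q \<in> points A"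
  using vector_field_on_openin openin_subset_points by blast

lemma vector_field_on_smooth:
  "vector_field_on A U X \<Longrightarrow> c \<in> A \<Longrightarrow> smooth_on (snd c ` (fst c \<inter> U)) (\<lambda>y. X (chart_inv c y) c)"
  unfolding vector_field_on_iff by blast

lemma vector_field_on_add:
  assumes "vector_field_on A U X" "vector_field_on A U Y"
  shows "vector_field_on A U (X + Y)"
proof -
  have "(X + Y) q \<in> tangent_space A q" if q: "q \<in> U" for q
  proof -
    obtain c where "c \<in> A" "q \<in> fst c"
      using vector_field_on_points[OF assms(1) q] unfolding points_def by blast
    then have "1 *\<^sub>R X q + 1 *\<^sub>R Y q \<in> tangent_space A q"
      by (intro tangent_space_add_scaleR vector_field_on_tangent[OF _ q] assms)
    then show ?thesis by simp
  qed
  moreover have "smooth_on (snd c ` (fst c \<inter> U)) (\<lambda>y. (X + Y) (chart_inv c y) c)" if "c \<in> A" for c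
    using smooth_on_add[OF open_chart_image_Int[OF that] vector_field_on_smooth vector_field_on_smooth]
      assms that vector_field_on_openin by (simp add: plus_fun_def)
  ultimately show ?thesis
    using vector_field_on_openin[OF assms(1)] unfolding vector_field_on_iff by blast
qed

lemma vector_field_on_scaleR:
  assumes "smooth_fun_on A U f" "vector_field_on A U X"
  shows "vector_field_on A U (\<lambda>q. f q *\<^sub>R X q)"
proof -
  have "f q *\<^sub>R X q \<in> tangent_space A q" if q: "q \<in> U" for q
  proof -
    obtain c where "c \<in> A" "q \<in> fst c"
      using vector_field_on_points[OF assms(2) q] unfolding points_def by blast
    then have "f q *\<^sub>R X q + 0 *\<^sub>R X q \<in> tangent_space A q"
      by (intro tangent_space_add_scaleR vector_field_on_tangent[OF _ q] assms)
    then show ?thesis by simp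
  qed
  moreover have "smooth_on (snd c ` (fst c \<inter> U)) (\<lambda>y. (f (chart_inv c y) *\<^sub>R X (chart_inv c y)) c)"
    if "c \<in> A" for c
    using smooth_on_scaleR[OF open_chart_image_Int[OF that] _ vector_field_on_smooth, of U "f \<circ> chart_inv c" X]
      assms that unfolding smooth_fun_on_iff by (simp add: scaleR_fun_def)
  ultimately show ?thesis
    using vector_field_on_openin[OF assms(2)] unfolding vector_field_on_iff by blast
qed

lemma vector_field_on_sum:
  assumes "finite I" "I \<noteq> {}" "\<And>i. i \<in> I \<Longrightarrow> vector_field_on A U (X i)"
  shows "vector_field_on A U (sum X I)"
  using assms by (induction I rule: finite_ne_induct) (auto intro: vector_field_on_add)

text \<open>These are the coefficients of a field in the coordinate frame; their smoothness is what
  the Leibniz rule of a connection asks for.\<close>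

lemma smooth_fun_component:
  assumes X: "vector_field_on A U X" and c: "c \<in> A"
  shows "smooth_fun_on A (U \<inter> fst c) (\<lambda>q. X q c \<bullet> w)"
  unfolding smooth_fun_on_iff
proof (intro conjI ballI)
  show op: "openin (atlas_topology A) (U \<inter> fst c)"
    using vector_field_on_openin[OF X] openin_chart[OF c] by blast
  fix d assume d: "d \<in> A"
  let ?S = "snd d ` (fst d \<inter> (U \<inter> fst c))"
  have o: "open ?S" by (rule open_chart_image_Int[OF d op])
  have t: "smooth_on ?S (transition d c)"
    by (rule smooth_on_subset[OF smooth_transition[OF d c]]) blast
  have s: "smooth_on ?S (\<lambda>y. X (chart_inv d y) d)"
    by (rule smooth_on_subset[OF vector_field_on_smooth[OF X d]]) blast
  have "smooth_on ?S (\<lambda>y. frechet_derivative (transition d c) (at y) (X (chart_inv d y) d) \<bullet> w)"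
    by (intro smooth_on_inner o smooth_on_const smooth_on_derivative_apply[OF o t _ s]
        smooth_on_linear bounded_linear_ident) auto
  then show "smooth_on ?S ((\<lambda>q. X q c \<bullet> w) \<circ> chart_inv d)"
    by (rule smooth_on_cong[OF _ o])
      (use c d X in \<open>auto simp: chart_inv_coord transition_coord tangent_space_component[of d _ c]
        vector_field_on_tangent\<close>)
qed

lemma smooth_fun_coord:
  assumes c: "c \<in> A"
  shows "smooth_fun_on A (fst c) (\<lambda>q. snd c q \<bullet> w)"
  unfolding smooth_fun_on_iff
proof (intro conjI ballI)
  fix d assume d: "d \<in> A"
  have "smooth_on (snd d ` (fst d \<inter> fst c)) (\<lambda>y. transition d c y \<bullet> w)"
    by (intro smooth_on_inner smooth_transition d c smooth_on_const open_overlap)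
  then show "smooth_on (snd d ` (fst d \<inter> fst c)) ((\<lambda>q. snd c q \<bullet> w) \<circ> chart_inv d)"
    by (simp add: o_def transition_chart_inv)
qed (rule openin_chart[OF c])

lemma sum_fun_apply: "(sum F I) x = (\<Sum>i\<in>I. F i x)"
  by (induction I rule: infinite_finite_induct) auto

lemma coord_field_expand:
  assumes "c \<in> A" "q \<in> fst c" "v \<in> tangent_space A q"
  shows "(\<Sum>i\<in>Basis. (v c \<bullet> i) *\<^sub>R tangent_of A c q i) = v"
  using linear_Basis_expand[OF linear_tangent_of[OF assms(1,2)], of "v c"]
    tangent_of_component[OF assms] by simp

subsection \<open>Connections in coordinates\<close>

lemmas is_connectionD = is_connection_def[THEN iffD1, THEN conjunct1, THEN spec, THEN spec,
  THEN spec, THEN mp, OF _ conjI]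

lemma connection_tangent:
  "is_connection A nabla \<Longrightarrow> vector_field_on A U Y \<Longrightarrow> q \<in> U \<Longrightarrow> v \<in> tangent_space A q \<Longrightarrow>
    nabla (q, v) Y \<in> tangent_space A q"
  unfolding is_connection_def by blast

lemma connection_linear:
  "is_connection A nabla \<Longrightarrow> vector_field_on A U Y \<Longrightarrow> q \<in> U \<Longrightarrow> v \<in> tangent_space A q \<Longrightarrow>
    w \<in> tangent_space A q \<Longrightarrow>
    nabla (q, a *\<^sub>R v + b *\<^sub>R w) Y = a *\<^sub>R nabla (q, v) Y + b *\<^sub>R nabla (q, w) Y"
  unfolding is_connection_def by blast

lemma connection_add:
  "is_connection A nabla \<Longrightarrow> vector_field_on A U Y \<Longrightarrow> vector_field_on A U Z \<Longrightarrow> q \<in> U \<Longrightarrow>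
    v \<in> tangent_space A q \<Longrightarrow> nabla (q, v) (Y + Z) = nabla (q, v) Y + nabla (q, v) Z"
  unfolding is_connection_def by blast

lemma connection_leibniz:
  "is_connection A nabla \<Longrightarrow> vector_field_on A U Y \<Longrightarrow> smooth_fun_on A U f \<Longrightarrow> q \<in> U \<Longrightarrow>
    v \<in> tangent_space A q \<Longrightarrow> nabla (q, v) (\<lambda>x. f x *\<^sub>R Y x) =
      pairing (differential A f q) (q, v) *\<^sub>R Y q + f q *\<^sub>R nabla (q, v) Y"
  unfolding is_connection_def by blast

lemma connection_local:
  assumes "is_connection A nabla" "vector_field_on A U Y" "\<And>x. x \<in> U \<Longrightarrow> Z x = Y x" "q \<in> U"
    "v \<in> tangent_space A q"
  shows "nabla (q, v) Z = nabla (q, v) Y"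
  using is_connectionD[OF assms(1,2,4), THEN conjunct2, THEN conjunct2, THEN conjunct2,
      THEN conjunct2, THEN spec, of Z] assms(3,5) by blast

lemma connection_vector_field:
  assumes "is_connection A nabla" "vector_field_on A U X" "vector_field_on A U Y"
  shows "vector_field_on A U (\<lambda>q. nabla (q, X q) Y)"
  using is_connection_def[THEN iffD1, OF assms(1), THEN conjunct2, THEN spec, THEN spec, THEN spec,
      of U X Y] assms(2,3) by blast

lemma connection_sum:
  assumes C: "is_connection A nabla" and "q \<in> U" "v \<in> tangent_space A q"
    and "finite I" "I \<noteq> {}" "\<And>i. i \<in> I \<Longrightarrow> vector_field_on A U (Y i)"
  shows "nabla (q, v) (sum Y I) = (\<Sum>i\<in>I. nabla (q, v) (Y i))"
  using assms(4-)
proof (induction I rule: finite_ne_induct)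
  case (insert i I)
  then show ?case
    using connection_add[OF C _ vector_field_on_sum, of U "Y i" I Y q v] assms(2,3)
    by (simp del: plus_fun_apply)
qed simp

text \<open>Expanding \<open>Y\<close> in the coordinate frame and applying additivity and the
  Leibniz rule gives the derivative of the coefficients plus a term with the connection coefficients
  (Christoffel symbols) \<open>nabla (q, v) (coord_field c i) c\<close>.\<close>

lemma connection_in_chart:
  assumes C: "is_connection A nabla" and c: "c \<in> A" and q: "q \<in> fst c" "q \<in> U"
    and Y: "vector_field_on A U Y" and v: "v \<in> tangent_space A q"
    and Y': "((\<lambda>y. Y (chart_inv c y) c) has_derivative Y') (at (snd c q))"
  shows "nabla (q, v) Y c = Y' (v c) + (\<Sum>i\<in>Basis. (Y q c \<bullet> i) *\<^sub>R nabla (q, v) (coord_field c i) c)"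
proof -
  \<comment> \<open>The frame lives on the chart domain and \<open>Y\<close> on \<open>U\<close>;
    locality of the connection allows passing to the intersection.\<close>
  let ?V = "U \<inter> fst c"
  define Z where "Z = (\<lambda>i x. (Y x c \<bullet> i) *\<^sub>R tangent_of A c x i)"
  have YV: "vector_field_on A ?V Y"
    by (rule vector_field_on_restrict[OF Y openin_chart[OF c]])
  have E: "vector_field_on A ?V (coord_field c i)" for i
    using vector_field_on_restrict[OF vector_field_coord_field[OF c] vector_field_on_openin[OF Y]]
    by (simp add: Int_commute)
  have Zf: "vector_field_on A ?V (Z i)" for i
    unfolding Z_def by (intro vector_field_on_scaleR smooth_fun_component Y c E)
  have "sum Z Basis x = Y x" if "x \<in> ?V" for x
    using that coord_field_expand[OF c _ vector_field_on_tangent[OF Y]]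
    by (simp add: sum_fun_apply Z_def)
  then have "nabla (q, v) Y = nabla (q, v) (sum Z Basis)"
    using connection_local[OF C YV _ _ v] q by (metis IntI)
  also have "\<dots> = (\<Sum>i\<in>Basis. nabla (q, v) (Z i))"
    using q by (intro connection_sum[OF C, where U="?V"] v Zf) auto
  also have "\<dots> = (\<Sum>i\<in>Basis. (Y' (v c) \<bullet> i) *\<^sub>R tangent_of A c q i +
      (Y q c \<bullet> i) *\<^sub>R nabla (q, v) (coord_field c i))"
  proof (rule sum.cong[OF refl])
    fix i :: 'e
    have "((\<lambda>x. Y x c \<bullet> i) \<circ> chart_inv c has_derivative (\<lambda>h. Y' h \<bullet> i)) (at (snd c q))"
      using Y' by (auto simp: o_def intro!: derivative_eq_intros)
    from differential_in_chart[OF c q(1) v this]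
    show "nabla (q, v) (Z i) = (Y' (v c) \<bullet> i) *\<^sub>R tangent_of A c q i +
      (Y q c \<bullet> i) *\<^sub>R nabla (q, v) (coord_field c i)"
      unfolding Z_def using q
      by (subst connection_leibniz[OF C E smooth_fun_component[OF Y c] _ v]) auto
  qed
  finally have "nabla (q, v) Y c = (\<Sum>i\<in>Basis. (Y' (v c) \<bullet> i) *\<^sub>R i +
      (Y q c \<bullet> i) *\<^sub>R nabla (q, v) (coord_field c i) c)"
    using c q by (simp add: sum_fun_apply tangent_of_self) (simp add: scaleR_fun_def tangent_of_self)
  then show ?thesis by (simp add: sum.distrib euclidean_representation)
qed

text \<open>Symmetry of the Christoffel symbols, as fields with constant components commute. The
  torsion identity is tested on the coordinate functions: their derivatives along such fields are
  constant, so both iterated derivatives vanish, and the differentials of coordinate functions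
  separate tangent vectors.\<close>

lemma torsion_free_coord_fields:
  assumes C: "is_connection A nabla" and T: "torsion_free A nabla" and c: "c \<in> A" and q: "q \<in> fst c"
  shows "nabla (q, tangent_of A c q v) (coord_field c w) = nabla (q, tangent_of A c q w) (coord_field c v)"
    (is "?a = ?b")
proof -
  note E = vector_field_coord_field[OF c]
  have ab: "?a \<in> tangent_space A q" "?b \<in> tangent_space A q"
    by (intro connection_tangent[OF C E q] tangent_of_in c q)+
  have d: "pairing (differential A (\<lambda>x. snd c x \<bullet> k) x) (x, u) = u c \<bullet> k"
    if x: "x \<in> fst c" and u: "u \<in> tangent_space A x" for k x u
  proof (rule differential_in_chart[OF c x u])
    have "((\<lambda>y. y \<bullet> k) has_derivative (\<lambda>h. h \<bullet> k)) (at (snd c x))"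
      by (auto intro!: derivative_eq_intros)
    then show "((\<lambda>x. snd c x \<bullet> k) \<circ> chart_inv c has_derivative (\<lambda>h. h \<bullet> k)) (at (snd c x))"
      by (rule has_derivative_transform_within_open[OF _ open_chart_image[OF c]])
        (use x c in \<open>auto simp: chart_inv_coord\<close>)
  qed
  have z: "pairing (differential A (\<lambda>x. pairing (differential A (\<lambda>x. snd c x \<bullet> k) x) (x, tangent_of A c x u)) q)
     (q, tangent_of A c q u') = 0" for k u u'
  proof (rule differential_in_chart[OF c q tangent_of_in[OF c q]])
    have "((\<lambda>y. u \<bullet> k) has_derivative (\<lambda>h. 0)) (at (snd c q))" by simp
    then show "((\<lambda>x. pairing (differential A (\<lambda>x. snd c x \<bullet> k) x) (x, tangent_of A c x u)) \<circ> chart_inv c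
        has_derivative (\<lambda>h. 0)) (at (snd c q))"
      by (rule has_derivative_transform_within_open[OF _ open_chart_image[OF c]])
        (use q c in \<open>auto simp: chart_inv_coord d tangent_of_in tangent_of_self\<close>)
  qed
  have "(?a - ?b) c \<bullet> k = 0" for k
  proof -
    have "pairing (differential A (\<lambda>x. snd c x \<bullet> k) q) (q, ?a - ?b) = 0"
      using T[unfolded torsion_free_def, THEN spec, THEN spec, THEN spec, THEN spec, THEN mp,
          OF conjI[OF E[of v] conjI[OF E[of w] smooth_fun_coord[OF c, of k]]], THEN bspec, OF q]
      by (simp only: z diff_self)
    moreover have "?a - ?b \<in> tangent_space A q"
      using subspace_diff[OF subspace_tangent_space[OF c q] ab] .
    ultimately show ?thesis using d[OF q] by simp
  qed
  then have "?a c = ?b c" by (metis (no_types) fun_diff_def inner_eq_zero_iff right_minus_eq)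
  then show ?thesis using tangent_space_eqI[OF c q ab] by simp
qed

subsection \<open>Horizontal lifts\<close>

lemma openin_euclidean_atlas: "open V \<Longrightarrow> openin (atlas_topology euclidean_atlas) V"
  unfolding atlas_topology_def euclidean_atlas_def
  by (rule topology_generated_by_Basis) auto

lemma chart_inv_euclidean: "chart_inv (UNIV, id) = id"
  by (simp add: chart_inv_def fun_eq_iff inv_into_f_f[of id UNIV, simplified])

lemma velocity_in_chart:
  assumes c: "c \<in> A" and y: "\<gamma> s \<in> snd c ` fst c" and d: "(\<gamma> has_vector_derivative w) (at s)"
  shows "velocity A (chart_inv c \<circ> \<gamma>) s =
    (chart_inv c (\<gamma> s), tangent_of A c (chart_inv c (\<gamma> s)) w)"
proof -
  let ?q = "chart_inv c (\<gamma> s)"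
  have q: "?q \<in> fst c" "snd c ?q = \<gamma> s" by (rule chart_inv_in[OF y], rule coord_chart_inv[OF y])
  have "vector_derivative (snd d \<circ> (chart_inv c \<circ> \<gamma>)) (at s) = D c d ?q w"
    if d': "d \<in> A" "?q \<in> fst d" for d
  proof -
    have "(transition c d has_derivative D c d ?q) (at (\<gamma> s))"
      using transition_has_derivative[OF c d'(1) q(1) d'(2)] q by simp
    then have "(transition c d \<circ> \<gamma> has_derivative D c d ?q \<circ> (\<lambda>h. h *\<^sub>R w)) (at s)"
      using d unfolding has_vector_derivative_def by (intro diff_chain_at)
    then have "(transition c d \<circ> \<gamma> has_vector_derivative D c d ?q w) (at s)"
      using linear_cmul[OF linear_D[OF c d'(1) q(1) d'(2)]]
      by (simp add: has_vector_derivative_def o_def)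
    then show ?thesis
      by (simp add: transition_def o_assoc vector_derivative_at)
  qed
  then show ?thesis
    by (auto simp: velocity_def tangent_of_def fun_eq_iff)
qed

text \<open>Membership of the curve in a second chart is an open condition by continuity of
  \<gamma>. There the momenta are obtained by the transpose of the derivative of the inverse
  transition, evaluated along the curve.\<close>

lemma smooth_cotangent_curve:
  assumes c: "c \<in> A" and J: "open J" and \<gamma>: "smooth_on J \<gamma>" "\<gamma> ` J \<subseteq> snd c ` fst c"
    and p: "smooth_on J p"
  shows "smooth_map_on euclidean_atlas J (cotangent_atlas A)
    (\<lambda>s::real. (chart_inv c (\<gamma> s), covec c (chart_inv c (\<gamma> s)) (p s)))"
    (is "smooth_map_on _ _ _ ?u")
  unfolding smooth_map_on_def Let_def
proof (intro conjI ballI)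
  show "openin (atlas_topology euclidean_atlas) J" by (rule openin_euclidean_atlas[OF J])
  have q: "chart_inv c (\<gamma> s) \<in> fst c" "snd c (chart_inv c (\<gamma> s)) = \<gamma> s" if "s \<in> J" for s
  proof -
    have *: "\<gamma> s \<in> snd c ` fst c" using \<gamma>(2) that by blast
    show "chart_inv c (\<gamma> s) \<in> fst c" "snd c (chart_inv c (\<gamma> s)) = \<gamma> s"
      by (rule chart_inv_in[OF *], rule coord_chart_inv[OF *])
  qed
  show "?u ` J \<subseteq> points (cotangent_atlas A)"
  proof (rule image_subsetI)
    fix s assume "s \<in> J"
    then have "?u s \<in> fst (cotangent_chart A c)"
      using q(1) covec_in[OF c] by (simp add: fst_cotangent_chart)
    then show "?u s \<in> points (cotangent_atlas A)"
      using c unfolding points_def cotangent_atlas_def by blast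
  qed
  fix b :: "(real, real) chart" and k assume "b \<in> euclidean_atlas" "k \<in> cotangent_atlas A"
  then obtain d where b: "b = (UNIV, id)" and d: "d \<in> A" "k = cotangent_chart A d"
    unfolding euclidean_atlas_def cotangent_atlas_def by blast
  let ?O = "snd c ` (fst c \<inter> fst d)"
  let ?S = "J \<inter> \<gamma> -` ?O"
  have S: "snd b ` {x \<in> fst b \<inter> J. ?u x \<in> fst k} = ?S"
  proof -
    have "\<gamma> s \<in> ?O \<longleftrightarrow> chart_inv c (\<gamma> s) \<in> fst d" if "s \<in> J" for s
      using image_chart_Int[OF c, of "\<gamma> s" "fst d"] \<gamma>(2) that by blast
    then show ?thesis
      using covec_in[OF c q(1)] by (auto simp: b d fst_cotangent_chart)
  qed
  have o: "open ?S"
    using continuous_open_preimage[OF smooth_on_continuous_on[OF \<gamma>(1)] J open_overlap[OF c d(1)]] .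
  then show "open (snd b ` {x \<in> fst b \<inter> J. ?u x \<in> fst k})" by (simp only: S)
  have s: "smooth_on ?S \<gamma>" "smooth_on ?S p"
    by (rule smooth_on_subset[OF \<gamma>(1)] smooth_on_subset[OF p], blast)+
  have t: "smooth_on ?S (\<lambda>s. transition c d (\<gamma> s))"
    by (rule smooth_on_compose[OF o smooth_transition[OF c d(1)] s(1)]) blast
  have "smooth_on ?S (\<lambda>s. frechet_derivative (transition d c) (at (transition c d (\<gamma> s))) j)" for j
    by (rule smooth_on_derivative_apply[OF o smooth_transition[OF d(1) c] t smooth_on_const[OF o]])
      (use c d in \<open>auto simp: transition_coord\<close>)
  then have "smooth_on ?S (\<lambda>s. (transition c d (\<gamma> s), \<Sum>j\<in>Basis.
      (p s \<bullet> frechet_derivative (transition d c) (at (transition c d (\<gamma> s))) j) *\<^sub>R j))"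
    by (intro smooth_on_Pair o t smooth_on_sum smooth_on_scaleR smooth_on_inner s smooth_on_const)
  then have "smooth_on ?S (snd k \<circ> ?u \<circ> chart_inv b)"
  proof (rule smooth_on_cong[OF _ o])
    fix s assume "s \<in> ?S"
    then have s: "s \<in> J" "chart_inv c (\<gamma> s) \<in> fst d" using image_chart_Int[OF c] by auto
    show "(snd k \<circ> ?u \<circ> chart_inv b) s = (transition c d (\<gamma> s), \<Sum>j\<in>Basis.
      (p s \<bullet> frechet_derivative (transition d c) (at (transition c d (\<gamma> s))) j) *\<^sub>R j)"
      using q[OF s(1)] s d c
      by (simp add: b d chart_inv_euclidean snd_cotangent_chart comps_def covec_def tangent_of_in
          tangent_of_eq transition_chart_inv)
  qed
  then show "smooth_on (snd b ` {x \<in> fst b \<inter> J. ?u x \<in> fst k}) (snd k \<circ> ?u \<circ> chart_inv b)"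
    by (simp only: S)
qed

text \<open>Over a straight line in a chart, parallelism of a covector tested on the coordinate
  frame is a linear equation for its momenta. A solution passes the test on every local field,
  because \<open>connection_in_chart\<close> expresses the covariant derivative of any field by
  those of the frame.\<close>

lemma horizontal_lift_exists:
  assumes C: "is_connection A nabla" and q: "q \<in> points A" and \<alpha>: "\<alpha> \<in> cotangent_space A q"
    and v: "v \<in> tangent_space A q"
  obtains e u where "0 < e" "horizontal_curve A nabla e u" "u 0 = (q, \<alpha>)"
    "velocity A (fst \<circ> u) 0 = (q, v)"
proof -
  obtain c where c: "c \<in> A" and qc: "q \<in> fst c" using q unfolding points_def by blast
  define w where "w = v c"
  define \<gamma> where "\<gamma> = (\<lambda>s::real. snd c q + s *\<^sub>R w)"
  define I where "I = \<gamma> -` (snd c ` fst c)"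
  have \<gamma>_smooth: "smooth_on UNIV \<gamma>"
    unfolding \<gamma>_def
    by (intro smooth_on_add smooth_on_const smooth_on_linear) (auto intro!: bounded_linear_intros)
  have \<gamma>': "(\<gamma> has_vector_derivative w) (at s)" for s
    unfolding \<gamma>_def by (auto intro!: derivative_eq_intros)
  have I: "open I"
    unfolding I_def using smooth_on_continuous_on[OF \<gamma>_smooth] open_chart_image[OF c]
    by (simp add: open_vimage)
  have I0: "0 \<in> I" using qc by (simp add: I_def \<gamma>_def)
  \<comment> \<open>The i-th momentum must change at the rate given by pairing the covector with the
    covariant derivative of the i-th coordinate field along the line; \<open>N i\<close> holds the
    components of that derivative.\<close>
  define N where "N = (\<lambda>i s. nabla (chart_inv c (\<gamma> s), tangent_of A c (chart_inv c (\<gamma> s)) w) (coord_field c i) c)"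
  have N: "smooth_on I (N i)" for i
  proof -
    have "vector_field_on A (fst c) (\<lambda>q. nabla (q, tangent_of A c q w) (coord_field c i))"
      by (intro connection_vector_field C vector_field_coord_field c)
    from vector_field_on_smooth[OF this c]
    show ?thesis
      unfolding N_def I_def
      by (intro smooth_on_compose[where g = "\<lambda>y. nabla (chart_inv c y, tangent_of A c (chart_inv c y) w)
          (coord_field c i) c", OF _ _ smooth_on_subset[OF \<gamma>_smooth]]) (auto simp: I[unfolded I_def])
  qed
  have "\<exists>e p. 0 < e \<and> {-e<..<e} \<subseteq> I \<and> p 0 = comps c q \<alpha> \<and> (\<forall>s\<in>{-e<..<e}.
       (p has_vector_derivative (\<Sum>i\<in>Basis. (p s \<bullet> N i s) *\<^sub>R i)) (at s))"
    by (rule linear_ode_exists[where N=N and ?p0.0="comps c q \<alpha>", OF I I0 smooth_on_continuous_on[OF N]])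
      blast
  then obtain e p where e: "0 < e" "{-e<..<e} \<subseteq> I" "p 0 = comps c q \<alpha>" and
    p': "\<And>s. s \<in> {-e<..<e} \<Longrightarrow>
       (p has_vector_derivative (\<Sum>i\<in>Basis. (p s \<bullet> N i s) *\<^sub>R i)) (at s)"
    by blast
  let ?J = "{-e<..<e}"
  have p: "smooth_on ?J p"
    by (rule linear_ode_smooth[OF _ smooth_on_subset[OF N e(2)] p']) auto
  have \<gamma>J: "\<gamma> s \<in> snd c ` fst c" if "s \<in> ?J" for s using that e(2) I_def by blast
  define u where "u = (\<lambda>s. (chart_inv c (\<gamma> s), covec c (chart_inv c (\<gamma> s)) (p s)))"
  have vel: "velocity A (fst \<circ> u) s = (chart_inv c (\<gamma> s), tangent_of A c (chart_inv c (\<gamma> s)) w)"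
    if "s \<in> ?J" for s
    using velocity_in_chart[OF c \<gamma>J[OF that] \<gamma>'] by (simp add: u_def o_def)
  have "horizontal_curve A nabla e u"
    unfolding horizontal_curve_def
  proof (intro conjI ballI allI impI)
    show "smooth_map_on euclidean_atlas ?J (cotangent_atlas A) u"
      unfolding u_def
      by (intro smooth_cotangent_curve c smooth_on_subset[OF \<gamma>_smooth] p) (use \<gamma>J in auto)
    fix s U Y assume s: "s \<in> ?J" and "vector_field_on A U Y \<and> fst (u s) \<in> U"
    then have Y: "vector_field_on A U Y" and U: "chart_inv c (\<gamma> s) \<in> U" by (auto simp: u_def)
    let ?q = "chart_inv c (\<gamma> s)"
    have qs: "?q \<in> fst c" "snd c ?q = \<gamma> s"
      using chart_inv_in[OF \<gamma>J[OF s]] coord_chart_inv[OF \<gamma>J[OF s]] by auto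
    let ?Y = "\<lambda>y. Y (chart_inv c y) c"
    let ?O = "snd c ` (fst c \<inter> U)"
    have O: "open ?O" by (rule open_chart_image_Int[OF c vector_field_on_openin[OF Y]])
    have sO: "\<gamma> s \<in> ?O" using image_chart_Int[OF c] \<gamma>J[OF s] U by blast
    obtain Y' where Y': "(?Y has_derivative Y') (at (\<gamma> s))"
      using smooth_on_has_derivative[OF vector_field_on_smooth[OF Y c] sO] by blast
    have dY: "((\<lambda>t. ?Y (\<gamma> t)) has_vector_derivative Y' w) (at s)"
      using diff_chain_at[OF \<gamma>'[unfolded has_vector_derivative_def] Y']
        linear_cmul[OF has_derivative_linear[OF Y']]
      by (simp add: has_vector_derivative_def o_def)
    \<comment> \<open>Product rule: the change of \<open>Y\<close> along the line gives the
      derivative term of \<open>connection_in_chart\<close>, and the change of \<open>p\<close>,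
      through the equation, gives the Christoffel term.\<close>
    have "((\<lambda>t. p t \<bullet> ?Y (\<gamma> t)) has_real_derivative
        p s \<bullet> Y' w + (\<Sum>i\<in>Basis. (p s \<bullet> N i s) *\<^sub>R i) \<bullet> ?Y (\<gamma> s)) (at s)"
      using bounded_bilinear.FDERIV[OF bounded_bilinear_inner
          p'[OF s, unfolded has_vector_derivative_def] dY[unfolded has_vector_derivative_def]]
      by (simp add: has_field_derivative_def algebra_simps)
        (simp add: mult_commute_abs flip: distrib_left)
    moreover have "p s \<bullet> Y' w + (\<Sum>i\<in>Basis. (p s \<bullet> N i s) *\<^sub>R i) \<bullet> ?Y (\<gamma> s) =
        pairing (u s) (fst (u s), nabla (velocity A (fst \<circ> u) s) Y)"
    proof -
      let ?v = "tangent_of A c ?q w"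
      have v: "?v \<in> tangent_space A ?q" by (rule tangent_of_in[OF c qs(1)])
      have "nabla (?q, ?v) Y \<in> tangent_space A ?q"
        by (rule connection_tangent[OF C Y U v])
      then have "pairing (u s) (fst (u s), nabla (velocity A (fst \<circ> u) s) Y) = p s \<bullet> nabla (?q, ?v) Y c"
        by (simp only: vel[OF s]) (simp add: u_def pairing_def covec_def)
      also have "nabla (?q, ?v) Y c = Y' w + (\<Sum>i\<in>Basis. (?Y (\<gamma> s) \<bullet> i) *\<^sub>R N i s)"
        using connection_in_chart[OF C c qs(1) U Y v, of Y'] Y' qs
        by (simp add: N_def tangent_of_self c)
      finally have "pairing (u s) (fst (u s), nabla (velocity A (fst \<circ> u) s) Y) =
        p s \<bullet> (Y' w + (\<Sum>i\<in>Basis. (?Y (\<gamma> s) \<bullet> i) *\<^sub>R N i s))" .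
      then show ?thesis
        by (simp only:) (simp add: inner_add_right inner_sum_left inner_sum_right inner_commute mult.commute)
    qed
    ultimately have "((\<lambda>t. p t \<bullet> ?Y (\<gamma> t)) has_real_derivative
      pairing (u s) (fst (u s), nabla (velocity A (fst \<circ> u) s) Y)) (at s)" by simp
    \<comment> \<open>Only while the line stays over \<open>U\<close> is \<open>Y\<close> known to
      be tangent, so the pairing is replaced by the inner product of components on this
      neighbourhood of \<open>s\<close>.\<close>
    moreover have "open (?J \<inter> \<gamma> -` ?O)"
      using smooth_on_continuous_on[OF \<gamma>_smooth] O by (intro open_Int open_vimage) auto
    ultimately show "((\<lambda>t. pairing (u t) (fst (u t), Y (fst (u t)))) has_real_derivative
         pairing (u s) (fst (u s), nabla (velocity A (fst \<circ> u) s) Y)) (at s)"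
    proof (rule has_field_derivative_transform_within_open)
      show "s \<in> ?J \<inter> \<gamma> -` ?O" using s sO by blast
      fix t assume "t \<in> ?J \<inter> \<gamma> -` ?O"
      then have "Y (chart_inv c (\<gamma> t)) \<in> tangent_space A (chart_inv c (\<gamma> t))"
        using vector_field_on_tangent[OF Y] image_chart_Int[OF c] by blast
      then show "p t \<bullet> ?Y (\<gamma> t) = pairing (u t) (fst (u t), Y (fst (u t)))"
        by (simp add: u_def pairing_def covec_def)
    qed
  qed
  moreover have "u 0 = (q, \<alpha>)"
    using c qc e(3) \<alpha> by (simp add: u_def \<gamma>_def chart_inv_coord covec_comps)
  moreover have "velocity A (fst \<circ> u) 0 = (q, v)"
    using vel[of 0] e(1) tangent_of_component[OF c qc v]
    by (simp add: \<gamma>_def chart_inv_coord c qc w_def)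
  ultimately show thesis using that e(1) by blast
qed

text \<open>Testing parallelism on the coordinate fields determines the derivative of each momentum
  at 0. The resulting coordinate velocity depends on the curve only through \<alpha> and
  \<open>v\<close>.\<close>

lemma horizontal_curve_in_chart:
  assumes e: "0 < e" and hc: "horizontal_curve A nabla e u" and u0: "u 0 = (q, \<alpha>)"
    and vel: "velocity A (fst \<circ> u) 0 = (q, v)" and c: "c \<in> A" "q \<in> fst c"
    and \<alpha>: "\<alpha> \<in> cotangent_space A q"
  shows "((snd (cotangent_chart A c) \<circ> u) has_vector_derivative
      (v c, \<Sum>i\<in>Basis. \<alpha> (nabla (q, v) (coord_field c i)) *\<^sub>R i)) (at 0)"
    and "\<exists>S. open S \<and> 0 \<in> S \<and> u ` S \<subseteq> fst (cotangent_chart A c)"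
proof -
  let ?J = "{-e<..<e}"
  let ?k = "cotangent_chart A c"
  let ?b = "(UNIV, id) :: (real, real) chart"
  let ?S = "snd ?b ` {x \<in> fst ?b \<inter> ?J. u x \<in> fst ?k}"
  have "smooth_map_on euclidean_atlas ?J (cotangent_atlas A) u"
    using hc unfolding horizontal_curve_def by blast
  moreover have "?b \<in> euclidean_atlas" "?k \<in> cotangent_atlas A"
    using c unfolding euclidean_atlas_def cotangent_atlas_def by auto
  ultimately have S: "open ?S" "smooth_on ?S (snd ?k \<circ> u \<circ> chart_inv ?b)"
    unfolding smooth_map_on_def Let_def by blast+
  have S0: "0 \<in> ?S" using e u0 \<alpha> c by (auto simp: fst_cotangent_chart)
  show "\<exists>S. open S \<and> 0 \<in> S \<and> u ` S \<subseteq> fst ?k"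
    using S(1) S0 by (intro exI[of _ ?S]) auto
  \<comment> \<open>\<open>velocity\<close> is written with \<open>vector_derivative\<close>, which
    describes an actual derivative only for a differentiable curve; smoothness of \<open>u\<close>
    provides this.\<close>
  have "(snd ?k \<circ> u) differentiable (at 0)"
    using smooth_on_has_derivative[OF S(2) S0] unfolding differentiable_def
    by (auto simp: chart_inv_euclidean)
  then have "(\<lambda>t. fst ((snd ?k \<circ> u) t)) differentiable (at 0)"
    unfolding differentiable_def by (blast intro: has_derivative_fst)
  then have "(snd c \<circ> (fst \<circ> u)) differentiable (at 0)"
    by (simp add: snd_cotangent_chart o_def)
  then have "((snd c \<circ> (fst \<circ> u)) has_vector_derivative vector_derivative (snd c \<circ> (fst \<circ> u)) (at 0)) (at 0)"
    by (simp add: vector_derivative_works)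
  moreover have "vector_derivative (snd c \<circ> (fst \<circ> u)) (at 0) = v c"
    using vel c u0 by (auto simp: velocity_def fun_eq_iff split: if_splits)
  ultimately have 1: "((\<lambda>t. snd c (fst (u t))) has_vector_derivative v c) (at 0)"
    by (simp add: o_def)
  have "((\<lambda>t. pairing (u t) (fst (u t), coord_field c i (fst (u t)))) has_real_derivative
      \<alpha> (nabla (q, v) (coord_field c i))) (at 0)" for i
  proof -
    have "((\<lambda>t. pairing (u t) (fst (u t), coord_field c i (fst (u t)))) has_real_derivative
      pairing (u 0) (fst (u 0), nabla (velocity A (fst \<circ> u) 0) (coord_field c i))) (at 0)"
      using hc[unfolded horizontal_curve_def, THEN conjunct2, THEN bspec, of 0, THEN spec, THEN spec,
          of "fst c" "coord_field c i"] vector_field_coord_field[OF c(1)] u0 c(2) e by auto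
    then show ?thesis by (simp only: vel) (simp add: u0 pairing_def)
  qed
  then have "((\<lambda>t. pairing (u t) (fst (u t), coord_field c i (fst (u t))) *\<^sub>R i) has_vector_derivative
      \<alpha> (nabla (q, v) (coord_field c i)) *\<^sub>R i) (at 0)" for i :: 'e
    unfolding has_real_derivative_iff_has_vector_derivative has_vector_derivative_def
    by (auto intro!: derivative_eq_intros)
  then have 2: "((\<lambda>t. comps c (fst (u t)) (snd (u t))) has_vector_derivative
      (\<Sum>i\<in>Basis. \<alpha> (nabla (q, v) (coord_field c i)) *\<^sub>R i)) (at 0)"
    by (auto simp: comps_def pairing_def intro!: has_vector_derivative_sum)
  show "((snd ?k \<circ> u) has_vector_derivative
      (v c, \<Sum>i\<in>Basis. \<alpha> (nabla (q, v) (coord_field c i)) *\<^sub>R i)) (at 0)"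
    using has_vector_derivative_Pair[OF 1 2] by (simp add: o_def snd_cotangent_chart)
qed

subsection \<open>Base derivative, fiber derivative and Poisson bracket in coordinates\<close>

text \<open>The candidate \<open>b\<close> has the right derivative along every horizontal curve by
  the common coordinate velocity and the chain rule, and it is a covector because the connection is
  linear in the direction.\<close>

lemma base_derivative_in_chart:
  assumes C: "is_connection A nabla" and c: "c \<in> A" "q \<in> fst c" and \<alpha>: "\<alpha> \<in> cotangent_space A q"
    and L: "((F \<circ> chart_inv (cotangent_chart A c)) has_derivative L) (at (snd c q, comps c q \<alpha>))"
    and v: "v \<in> tangent_space A q"
  shows "pairing (base_derivative A nabla F (q, \<alpha>)) (q, v) =
    L (v c, \<Sum>i\<in>Basis. \<alpha> (nabla (q, v) (coord_field c i)) *\<^sub>R i)"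
proof -
  let ?k = "cotangent_chart A c"
  define l where "l = (\<lambda>v. L (v c, \<Sum>i\<in>Basis. \<alpha> (nabla (q, v) (coord_field c i)) *\<^sub>R i))"
  define b where "b = (q, \<lambda>v. if v \<in> tangent_space A q then l v else 0)"
  note E = vector_field_coord_field[OF c(1)]
  have lin: "l (s *\<^sub>R v + t *\<^sub>R w) = s * l v + t * l w"
    if "v \<in> tangent_space A q" "w \<in> tangent_space A q" for v w s t
  proof -
    have "(\<Sum>i\<in>Basis. \<alpha> (nabla (q, s *\<^sub>R v + t *\<^sub>R w) (coord_field c i)) *\<^sub>R i) =
      s *\<^sub>R (\<Sum>i\<in>Basis. \<alpha> (nabla (q, v) (coord_field c i)) *\<^sub>R i) +
      t *\<^sub>R (\<Sum>i\<in>Basis. \<alpha> (nabla (q, w) (coord_field c i)) *\<^sub>R i)"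
      using cotangent_space_linear[OF \<alpha> connection_tangent[OF C E c(2)] connection_tangent[OF C E c(2)]] that
      by (simp only: connection_linear[OF C E c(2) that])
        (simp add: scaleR_add_left sum.distrib scaleR_sum_right)
    then have "(( s *\<^sub>R v + t *\<^sub>R w) c, \<Sum>i\<in>Basis. \<alpha> (nabla (q, s *\<^sub>R v + t *\<^sub>R w) (coord_field c i)) *\<^sub>R i) =
      s *\<^sub>R (v c, \<Sum>i\<in>Basis. \<alpha> (nabla (q, v) (coord_field c i)) *\<^sub>R i) +
      t *\<^sub>R (w c, \<Sum>i\<in>Basis. \<alpha> (nabla (q, w) (coord_field c i)) *\<^sub>R i)"
      by (simp add: plus_fun_def scaleR_fun_def)
    then show ?thesis
      using has_derivative_linear[OF L] unfolding l_def
      by (simp only: linear_add linear_cmul real_scaleR_def)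
  qed
  have b: "b \<in> cotangent_bundle A"
    using lin in_points[OF c] tangent_space_add_scaleR[OF c]
    unfolding b_def cotangent_bundle_def cotangent_space_def by simp
  have der: "((F \<circ> u) has_real_derivative l v) (at 0)"
    if v: "v \<in> tangent_space A q" and u: "0 < e" "horizontal_curve A nabla e u" "u 0 = (q, \<alpha>)"
      "velocity A (fst \<circ> u) 0 = (q, v)" for v e u
  proof -
    obtain S where S: "open S" "0 \<in> S" "u ` S \<subseteq> fst ?k"
      using horizontal_curve_in_chart(2)[OF u c \<alpha>] by blast
    have "((F \<circ> chart_inv ?k) has_derivative L) (at ((snd ?k \<circ> u) 0))"
      using L u(3) by (simp add: snd_cotangent_chart)
    from diff_chain_at[OF horizontal_curve_in_chart(1)[OF u c \<alpha>, unfolded has_vector_derivative_def] this]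
    have "(F \<circ> chart_inv ?k \<circ> (snd ?k \<circ> u) has_derivative (\<lambda>h. h * l v)) (at 0)"
      using linear_cmul[OF has_derivative_linear[OF L]] by (simp only: o_def l_def real_scaleR_def)
    then have "(F \<circ> u has_derivative (\<lambda>h. h * l v)) (at 0)"
    proof (rule has_derivative_transform_within_open[OF _ S(1,2)])
      fix t assume "t \<in> S"
      then have "fst (u t) \<in> fst c" "snd (u t) \<in> cotangent_space A (fst (u t))"
        using S(3) by (auto simp: fst_cotangent_chart)
      then show "(F \<circ> chart_inv ?k \<circ> (snd ?k \<circ> u)) t = (F \<circ> u) t"
        using c by (simp add: snd_cotangent_chart chart_inv_cotangent_coord)
    qed
    then show ?thesis by (simp add: has_field_derivative_def mult_commute_abs)
  qed
  have "base_derivative A nabla F (q, \<alpha>) = b"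
    unfolding base_derivative_def
  proof (rule the_equality)
    show "b \<in> cotangent_bundle A \<and> fst b = fst (q, \<alpha>) \<and> (\<forall>v\<in>tangent_space A (fst (q, \<alpha>)). \<forall>e>0. \<forall>u.
      horizontal_curve A nabla e u \<and> u 0 = (q, \<alpha>) \<and> velocity A (fst \<circ> u) 0 = (fst (q, \<alpha>), v) \<longrightarrow>
      (F \<circ> u has_real_derivative pairing b (fst (q, \<alpha>), v)) (at 0))"
      using b der by (auto simp: b_def pairing_def)
  next
    fix b' assume b': "b' \<in> cotangent_bundle A \<and> fst b' = fst (q, \<alpha>) \<and> (\<forall>v\<in>tangent_space A (fst (q, \<alpha>)). \<forall>e>0. \<forall>u.
      horizontal_curve A nabla e u \<and> u 0 = (q, \<alpha>) \<and> velocity A (fst \<circ> u) 0 = (fst (q, \<alpha>), v) \<longrightarrow>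
      (F \<circ> u has_real_derivative pairing b' (fst (q, \<alpha>), v)) (at 0))"
    have "snd b' v = snd b v" for v
    proof (cases "v \<in> tangent_space A q")
      case True
      \<comment> \<open>A competing covector \<open>b'\<close> is compared with \<open>b\<close> at
        \<open>v\<close> along a single lift with initial velocity \<open>v\<close>.\<close>
      obtain e u where u: "0 < e" "horizontal_curve A nabla e u" "u 0 = (q, \<alpha>)"
        "velocity A (fst \<circ> u) 0 = (q, v)"
        by (rule horizontal_lift_exists[OF C in_points[OF c] \<alpha> True])
      have "(F \<circ> u has_real_derivative pairing b' (q, v)) (at 0)"
        using b' u True by auto
      from DERIV_unique[OF this der[OF True u]] True show ?thesis
        by (simp add: pairing_def b_def)
    next
      case False
      moreover have "snd b' \<in> cotangent_space A q"
        using b' unfolding cotangent_bundle_def by auto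
      ultimately show ?thesis by (simp add: b_def cotangent_space_def)
    qed
    then show "b' = b" using b' by (auto simp: b_def prod_eq_iff fun_eq_iff)
  qed
  then show ?thesis using v by (simp add: b_def pairing_def l_def)
qed

text \<open>A line in the fiber moves only the momenta, so the chain rule leaves
  \<open>L (0, comps c q \<beta>)\<close>, a linear form in \<beta> represented by the given vector.
  Testing with the covectors \<open>covec c q i\<close> shows that no other vector represents
  it.\<close>

lemma fiber_derivative_in_chart:
  assumes c: "c \<in> A" "q \<in> fst c" and \<alpha>: "\<alpha> \<in> cotangent_space A q"
    and L: "((F \<circ> chart_inv (cotangent_chart A c)) has_derivative L) (at (snd c q, comps c q \<alpha>))"
  shows "fiber_derivative A F (q, \<alpha>) = (q, tangent_of A c q (\<Sum>i\<in>Basis. L (0, i) *\<^sub>R i))"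
proof -
  define v where "v = tangent_of A c q (\<Sum>i\<in>Basis. L (0, i) *\<^sub>R i)"
  have v: "v \<in> tangent_space A q" unfolding v_def by (rule tangent_of_in[OF c])
  have l: "linear (\<lambda>b. L (0, b))"
    using has_derivative_linear[OF L]
    by (intro linearI) (simp_all add: linear_add[symmetric] linear_cmul[symmetric] flip: real_scaleR_def)
  have der: "((\<lambda>s. F (q, \<alpha> + s *\<^sub>R \<beta>)) has_real_derivative \<beta> v) (at 0)"
    if \<beta>: "\<beta> \<in> cotangent_space A q" for \<beta>
  proof -
    let ?\<gamma> = "\<lambda>s. (snd c q, comps c q \<alpha> + s *\<^sub>R comps c q \<beta>)"
    have "(?\<gamma> has_derivative (\<lambda>h. (0, h *\<^sub>R comps c q \<beta>))) (at 0)"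
      by (auto intro!: derivative_eq_intros)
    from diff_chain_at[OF this, of "F \<circ> chart_inv (cotangent_chart A c)" L]
    have "((F \<circ> chart_inv (cotangent_chart A c)) \<circ> ?\<gamma> has_derivative L \<circ> (\<lambda>h. (0, h *\<^sub>R comps c q \<beta>))) (at 0)"
      using L by simp
    moreover have "(F \<circ> chart_inv (cotangent_chart A c)) \<circ> ?\<gamma> = (\<lambda>s. F (q, \<alpha> + s *\<^sub>R \<beta>))"
      using chart_inv_cotangent_coord[OF c cotangent_space_add_scaleR[OF \<alpha> \<beta>]]
      by (simp add: fun_eq_iff comps_add_scaleR)
    moreover have "L \<circ> (\<lambda>h. (0, h *\<^sub>R comps c q \<beta>)) = (\<lambda>h. h * \<beta> v)"
    proof
      fix h
      have "\<beta> v = comps c q \<beta> \<bullet> (\<Sum>i\<in>Basis. L (0, i) *\<^sub>R i)"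
        using covector_eq[OF c \<beta> v] by (simp add: v_def tangent_of_self c)
      also have "\<dots> = L (0, comps c q \<beta>)"
        using linear_Basis_expand[OF l, of "comps c q \<beta>"] by (simp add: inner_sum_right mult.commute)
      finally show "(L \<circ> (\<lambda>h. (0, h *\<^sub>R comps c q \<beta>))) h = h * \<beta> v"
        using linear_cmul[OF l] by simp
    qed
    ultimately show ?thesis by (simp add: has_field_derivative_def mult_commute_abs)
  qed
  have "fiber_derivative A F (q, \<alpha>) = (q, v)"
    unfolding fiber_derivative_def
  proof (rule the_equality)
    show "(q, v) \<in> tangent_bundle A \<and> fst (q, v) = fst (q, \<alpha>) \<and>
      (\<forall>\<beta>\<in>cotangent_space A (fst (q, \<alpha>)). ((\<lambda>s. F (fst (q, \<alpha>), snd (q, \<alpha>) + s *\<^sub>R \<beta>)) has_real_derivative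
        pairing (fst (q, \<alpha>), \<beta>) (q, v)) (at 0))"
      using v der in_points[OF c] by (simp add: tangent_bundle_def pairing_def)
  next
    fix w assume w: "w \<in> tangent_bundle A \<and> fst w = fst (q, \<alpha>) \<and>
      (\<forall>\<beta>\<in>cotangent_space A (fst (q, \<alpha>)). ((\<lambda>s. F (fst (q, \<alpha>), snd (q, \<alpha>) + s *\<^sub>R \<beta>)) has_real_derivative
        pairing (fst (q, \<alpha>), \<beta>) w) (at 0))"
    then have wt: "snd w \<in> tangent_space A q" by (auto simp: tangent_bundle_def)
    have "snd w c \<bullet> i = v c \<bullet> i" for i
    proof -
      have "covec c q i (snd w) = covec c q i v"
        using DERIV_unique[OF _ der[OF covec_in[OF c]]] w covec_in[OF c] by (simp add: pairing_def)
      then show ?thesis using wt v by (simp add: covec_def inner_commute)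
    qed
    then have "snd w c = v c" by (rule euclidean_eqI)
    then have "snd w = v" by (rule tangent_space_eqI[OF c wt v])
    then show "w = (q, v)" using w by (auto simp: prod_eq_iff)
  qed
  then show ?thesis by (simp add: v_def)
qed

text \<open>The bracket is defined in the chart \<open>chart_at A q\<close>, which therefore fixes
  the chart for the identities that involve it.\<close>

lemma poisson_bracket_in_chart:
  assumes c: "c = chart_at A q"
    and L: "((F \<circ> chart_inv (cotangent_chart A c)) has_derivative L) (at (snd c q, comps c q \<alpha>))"
    and L': "((G \<circ> chart_inv (cotangent_chart A c)) has_derivative L') (at (snd c q, comps c q \<alpha>))"
  shows "poisson_bracket A F G (q, \<alpha>) = (\<Sum>i\<in>Basis. L (i, 0) * L' (0, i) - L' (i, 0) * L (0, i))"
  unfolding poisson_bracket_def Let_def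
  by (simp add: snd_cotangent_chart flip: c frechet_derivative_at[OF L] frechet_derivative_at[OF L'])

text \<open>Only the symmetric part of the connection coefficients enters the base derivatives paired
  with fiber derivatives, so for a torsion-free connection their contributions cancel.\<close>

lemma poisson_bracket_base_fiber:
  assumes C: "is_connection A nabla" "torsion_free A nabla" and q: "q \<in> points A"
    and \<alpha>: "\<alpha> \<in> cotangent_space A q" and c: "c = chart_at A q"
    and L: "((F \<circ> chart_inv (cotangent_chart A c)) has_derivative L) (at (snd c q, comps c q \<alpha>))"
    and L': "((G \<circ> chart_inv (cotangent_chart A c)) has_derivative L') (at (snd c q, comps c q \<alpha>))"
  shows "pairing (base_derivative A nabla F (q, \<alpha>)) (fiber_derivative A G (q, \<alpha>)) -
    pairing (base_derivative A nabla G (q, \<alpha>)) (fiber_derivative A F (q, \<alpha>)) =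
    poisson_bracket A F G (q, \<alpha>)"
proof -
  have cA: "c \<in> A" "q \<in> fst c" using chart_at[OF q] c by auto
  have *: "pairing (base_derivative A nabla F (q, \<alpha>)) (fiber_derivative A G (q, \<alpha>)) =
     (\<Sum>i\<in>Basis. L (i, 0) * L' (0, i)) +
     \<alpha> (nabla (q, tangent_of A c q (\<Sum>i\<in>Basis. L (0, i) *\<^sub>R i))
         (coord_field c (\<Sum>i\<in>Basis. L' (0, i) *\<^sub>R i)))"
    if L: "((F \<circ> chart_inv (cotangent_chart A c)) has_derivative L) (at (snd c q, comps c q \<alpha>))"
    and L': "((G \<circ> chart_inv (cotangent_chart A c)) has_derivative L') (at (snd c q, comps c q \<alpha>))"
    for F G L L'
  proof -
    define x where "x = (\<Sum>i\<in>Basis. L' (0, i) *\<^sub>R i)"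
    define z where "z = (\<Sum>i\<in>Basis. L (0, i) *\<^sub>R i)"
    let ?g = "\<lambda>i. \<alpha> (nabla (q, tangent_of A c q i) (coord_field c x))"
    note E = vector_field_coord_field[OF cA(1)]
    note ll = has_derivative_linear[OF L]
    have l1: "linear (\<lambda>a. L (a, 0))" and l2: "linear (\<lambda>b. L (0, b))"
      using ll by (auto intro!: linearI simp add: linear_add[symmetric] linear_cmul[symmetric]
          simp flip: real_scaleR_def)
    have gl: "linear ?g"
    proof (rule linearI)
      note lt = linear_tangent_of[OF cA]
      note tt = tangent_of_in[OF cA]
      note ct = connection_tangent[OF C(1) E[of x] cA(2) tt]
      show "?g (a + b) = ?g a + ?g b" for a b
        using connection_linear[OF C(1) E[of x] cA(2) tt[of a] tt[of b], where a=1 and b=1]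
          cotangent_space_linear[OF \<alpha> ct[of a] ct[of b], where a=1 and b=1] by (simp add: linear_add[OF lt])
      show "?g (r *\<^sub>R a) = r *\<^sub>R ?g a" for r a
        using connection_linear[OF C(1) E[of x] cA(2) tt[of a] tt[of a], where a=r and b=0]
          cotangent_space_scaleR[OF \<alpha> ct[of a], of r] by (simp add: linear_cmul[OF lt])
    qed
    have "pairing (base_derivative A nabla F (q, \<alpha>)) (fiber_derivative A G (q, \<alpha>)) =
      L (x, \<Sum>i\<in>Basis. \<alpha> (nabla (q, tangent_of A c q x) (coord_field c i)) *\<^sub>R i)"
      using base_derivative_in_chart[OF C(1) cA \<alpha> L tangent_of_in[OF cA, of x]]
      by (simp add: fiber_derivative_in_chart[OF cA \<alpha> L'] tangent_of_self[OF cA] flip: x_def)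
    \<comment> \<open>Symmetry of the coefficients moves the index \<open>i\<close> from the field
      to the direction, where the connection is linear pointwise; so the sum against
      \<open>L (0, i)\<close> collapses to the direction \<open>z\<close>.\<close>
    also have "(\<Sum>i\<in>Basis. \<alpha> (nabla (q, tangent_of A c q x) (coord_field c i)) *\<^sub>R i) = (\<Sum>i\<in>Basis. ?g i *\<^sub>R i)"
      by (rule sum.cong[OF refl]) (simp only: torsion_free_coord_fields[OF C cA, of x])
    also have "L (x, \<Sum>i\<in>Basis. ?g i *\<^sub>R i) = L (x, 0) + L (0, \<Sum>i\<in>Basis. ?g i *\<^sub>R i)"
      using linear_add[OF ll, of "(x, 0)" "(0, \<Sum>i\<in>Basis. ?g i *\<^sub>R i)"] by simp
    also have "L (0, \<Sum>i\<in>Basis. ?g i *\<^sub>R i) = (\<Sum>i\<in>Basis. ?g i * L (0, i))"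
      by (simp add: linear_sum[OF l2] linear_cmul[OF l2])
    also have "\<dots> = ?g z"
      unfolding z_def by (simp add: linear_sum[OF gl] linear_cmul[OF gl] mult.commute)
    also have "L (x, 0) = (\<Sum>i\<in>Basis. L (i, 0) * L' (0, i))"
      unfolding x_def by (simp add: linear_sum[OF l1] linear_cmul[OF l1] mult.commute)
    finally show ?thesis by (simp add: x_def z_def)
  qed
  \<comment> \<open>The connection terms of the two pairings have direction and field interchanged;
    they agree by torsion-freeness and cancel, leaving the bracket.\<close>
  show ?thesis
    using *[OF L L'] *[OF L' L] torsion_free_coord_fields[OF C cA, of "\<Sum>i\<in>Basis. L (0, i) *\<^sub>R i"]
    by (simp add: poisson_bracket_in_chart[OF c L L'] sum_subtractf)
qed

subsection \<open>Kinetic energies\<close>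

text \<open>The lowering of an index by the metric (the flat map, inverse to \<open>sharp\<close>),
  read in a chart as an endomorphism of the model space.\<close>

definition gram :: "('q \<Rightarrow> ('q, 'e) tvec \<Rightarrow> ('q, 'e) tvec \<Rightarrow> real) \<Rightarrow> ('q, 'e) chart \<Rightarrow> 'q \<Rightarrow> 'e \<Rightarrow> 'e"
  where "gram \<rho> c q x = (\<Sum>i\<in>Basis. \<rho> q (tangent_of A c q x) (tangent_of A c q i) *\<^sub>R i)"

context
  fixes \<rho> :: "'q \<Rightarrow> ('q, 'e) tvec \<Rightarrow> ('q, 'e) tvec \<Rightarrow> real"
  assumes R: "riemannian_metric A \<rho>"
begin

lemma metric_linear:
  "q \<in> points A \<Longrightarrow> u \<in> tangent_space A q \<Longrightarrow> v \<in> tangent_space A q \<Longrightarrow> w \<in> tangent_space A q \<Longrightarrow>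
    \<rho> q (a *\<^sub>R u + b *\<^sub>R v) w = a * \<rho> q u w + b * \<rho> q v w"
  by (rule R[unfolded riemannian_metric_def, THEN conjunct1, THEN bspec, THEN bspec, THEN bspec,
        THEN bspec, THEN spec, THEN spec])

lemma metric_sym:
  "q \<in> points A \<Longrightarrow> u \<in> tangent_space A q \<Longrightarrow> v \<in> tangent_space A q \<Longrightarrow> \<rho> q u v = \<rho> q v u"
  by (rule R[unfolded riemannian_metric_def, THEN conjunct2, THEN conjunct1, THEN bspec, THEN bspec,
        THEN bspec])

lemma metric_pos:
  "q \<in> points A \<Longrightarrow> u \<in> tangent_space A q \<Longrightarrow> u \<noteq> 0 \<Longrightarrow> \<rho> q u u > 0"
  using R unfolding riemannian_metric_def by blast

lemma metric_smooth:
  "vector_field_on A U X \<Longrightarrow> vector_field_on A U Y \<Longrightarrow> smooth_fun_on A U (\<lambda>q. \<rho> q (X q) (Y q))"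
  by (rule R[unfolded riemannian_metric_def, THEN conjunct2, THEN conjunct2, THEN conjunct2, THEN spec,
        THEN spec, THEN spec, THEN mp, OF conjI])

lemma metric_linear_coord:
  assumes c: "c \<in> A" "q \<in> fst c" and w: "w \<in> tangent_space A q"
  shows "linear (\<lambda>x. \<rho> q (tangent_of A c q x) w)"
proof (rule linearI)
  note lt = linear_tangent_of[OF c] and tt = tangent_of_in[OF c] and p = in_points[OF c]
  show "\<rho> q (tangent_of A c q (x + y)) w = \<rho> q (tangent_of A c q x) w + \<rho> q (tangent_of A c q y) w" for x y
    using metric_linear[OF p tt[of x] tt[of y] w, where a=1 and b=1] by (simp add: linear_add[OF lt])
  show "\<rho> q (tangent_of A c q (r *\<^sub>R x)) w = r *\<^sub>R \<rho> q (tangent_of A c q x) w" for r x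
    using metric_linear[OF p tt[of x] tt[of x] w, where a=r and b=0] by (simp add: linear_cmul[OF lt])
qed

lemma linear_gram:
  assumes c: "c \<in> A" "q \<in> fst c" shows "linear (gram \<rho> c q)"
proof -
  note l = metric_linear_coord[OF c tangent_of_in[OF c]]
  show ?thesis
    unfolding gram_def
    by (rule linearI) (simp_all add: linear_add[OF l] linear_cmul[OF l] scaleR_add_left sum.distrib scaleR_sum_right)
qed

lemma gram_inner:
  assumes c: "c \<in> A" "q \<in> fst c"
  shows "gram \<rho> c q x \<bullet> y = \<rho> q (tangent_of A c q x) (tangent_of A c q y)"
proof -
  note tt = tangent_of_in[OF c] and p = in_points[OF c]
  have s: "\<rho> q (tangent_of A c q x) (tangent_of A c q i) = \<rho> q (tangent_of A c q i) (tangent_of A c q x)" for i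
    by (rule metric_sym[OF p tt tt])
  have "gram \<rho> c q x \<bullet> y = (\<Sum>i\<in>Basis. (y \<bullet> i) *\<^sub>R \<rho> q (tangent_of A c q i) (tangent_of A c q x))"
    by (simp only: gram_def inner_sum_left inner_scaleR_left inner_sum_right inner_scaleR_right s
        inner_commute[of _ y] real_scaleR_def mult.commute)
  also have "\<dots> = \<rho> q (tangent_of A c q y) (tangent_of A c q x)"
    by (rule linear_Basis_expand[OF metric_linear_coord[OF c tt], symmetric])
  finally show ?thesis by (simp only: s[of y])
qed

text \<open>Positive definiteness makes the kernel trivial, and finite dimension gives surjectivity.
  Every momentum is thus \<open>gram \<rho> c q x\<close> for some \<open>x\<close>, which lets
  \<open>sharp\<close> and \<open>kinetic\<close> be evaluated without a formula for the inverse
  matrix.\<close>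

lemma bij_gram:
  assumes c: "c \<in> A" "q \<in> fst c"
  shows "inj (gram \<rho> c q)" and "surj (gram \<rho> c q)"
proof -
  show "inj (gram \<rho> c q)"
    unfolding linear_injective_0[OF linear_gram[OF c]]
  proof (intro allI impI)
    fix x assume "gram \<rho> c q x = 0"
    then have "\<rho> q (tangent_of A c q x) (tangent_of A c q x) = 0" using gram_inner[OF c, of x x] by simp
    then have "tangent_of A c q x = 0"
      using metric_pos[OF in_points[OF c] tangent_of_in[OF c, of x]] by fastforce
    then show "x = 0" using tangent_of_self[OF c, of x] by simp
  qed
  then show "surj (gram \<rho> c q)"
    by (rule linear_inj_imp_surj[OF linear_gram[OF c]])
qed

lemma sharp_covec_gram:
  assumes c: "c \<in> A" "q \<in> fst c"
  shows "sharp A \<rho> (q, covec c q (gram \<rho> c q x)) = (q, tangent_of A c q x)"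
proof -
  have "(THE v. v \<in> tangent_space A q \<and> (\<forall>w\<in>tangent_space A q. \<rho> q v w = covec c q (gram \<rho> c q x) w))
    = tangent_of A c q x"
  proof (rule the_equality)
    show "tangent_of A c q x \<in> tangent_space A q \<and>
      (\<forall>w\<in>tangent_space A q. \<rho> q (tangent_of A c q x) w = covec c q (gram \<rho> c q x) w)"
      using tangent_of_in[OF c] by (simp add: covec_def gram_inner[OF c] tangent_of_component[OF c])
  next
    fix v assume v: "v \<in> tangent_space A q \<and> (\<forall>w\<in>tangent_space A q. \<rho> q v w = covec c q (gram \<rho> c q x) w)"
    have g: "gram \<rho> c q (v c) \<bullet> y = gram \<rho> c q x \<bullet> y" for y
    proof -
      have "gram \<rho> c q (v c) \<bullet> y = \<rho> q v (tangent_of A c q y)"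
        using gram_inner[OF c, of "v c" y] tangent_of_component[OF c] v by simp
      also have "\<dots> = covec c q (gram \<rho> c q x) (tangent_of A c q y)"
        using v tangent_of_in[OF c, of y] by blast
      also have "\<dots> = gram \<rho> c q x \<bullet> y" by (rule covec_tangent_of[OF c])
      finally show ?thesis .
    qed
    have "gram \<rho> c q (v c) = gram \<rho> c q x" by (rule euclidean_eqI) (rule g)
    then have "v c = x" by (rule injD[OF bij_gram(1)[OF c]])
    then show "v = tangent_of A c q x" using tangent_of_component[OF c, of v] v by simp
  qed
  then show ?thesis by (simp add: sharp_def)
qed

lemma kinetic_covec_gram:
  assumes c: "c \<in> A" "q \<in> fst c"
  shows "kinetic A \<rho> (q, covec c q (gram \<rho> c q x)) = 1/2 * (gram \<rho> c q x \<bullet> x)"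
  by (simp add: kinetic_def sharp_covec_gram[OF c] pairing_def covec_tangent_of[OF c])

lemma kinetic_covec_scaleR:
  assumes c: "c \<in> A" "q \<in> fst c"
  shows "kinetic A \<rho> (q, covec c q (t *\<^sub>R p)) = t\<^sup>2 * kinetic A \<rho> (q, covec c q p)"
proof -
  obtain x where x: "p = gram \<rho> c q x" using bij_gram(2)[OF c] by (metis surjD)
  have "kinetic A \<rho> (q, covec c q (t *\<^sub>R gram \<rho> c q x)) = 1/2 * ((t *\<^sub>R gram \<rho> c q x) \<bullet> (t *\<^sub>R x))"
    using kinetic_covec_gram[OF c, of "t *\<^sub>R x"] unfolding linear_cmul[OF linear_gram[OF c]] .
  then show ?thesis by (simp add: x kinetic_covec_gram[OF c] power2_eq_square)
qed

text \<open>By linearity in the fiber the derivative is \<open>gram\<close> itself in fiber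
  directions. The part in base directions is an unspecified \<open>K\<close>: the joint derivative
  with the base projection is block triangular, hence invertible whatever \<open>K\<close>
  is.\<close>

lemma gram_has_derivative:
  assumes c: "c \<in> A" and y: "y \<in> snd c ` fst c"
  obtains K where "((\<lambda>z. gram \<rho> c (chart_inv c (fst z)) (snd z)) has_derivative
    (\<lambda>h. gram \<rho> c (chart_inv c y) (snd h) + K (fst h))) (at (y, x))"
proof -
  let ?g = "\<lambda>j i y. \<rho> (chart_inv c y) (tangent_of A c (chart_inv c y) j) (tangent_of A c (chart_inv c y) i)"
  have O: "open (snd c ` fst c)" by (rule open_chart_image[OF c])
  have gram: "gram \<rho> c (chart_inv c y) x = (\<Sum>i\<in>Basis. (\<Sum>j\<in>Basis. (x \<bullet> j) * ?g j i y) *\<^sub>R i)"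
    if "y \<in> snd c ` fst c" for y x
    unfolding gram_def
    using linear_Basis_expand[OF metric_linear_coord[OF c chart_inv_in[OF that]
          tangent_of_in[OF c chart_inv_in[OF that]]], of x] by simp
  define g' where "g' = (\<lambda>j i. frechet_derivative (?g j i) (at y))"
  have g': "(?g j i has_derivative g' j i) (at y)" for i j
  proof -
    have "smooth_fun_on A (fst c) (\<lambda>q. \<rho> q (tangent_of A c q j) (tangent_of A c q i))"
      by (intro metric_smooth vector_field_coord_field c)
    then have "smooth_on (snd c ` fst c) (?g j i)"
      using c unfolding smooth_fun_on_iff by (auto simp: o_def)
    then show ?thesis unfolding g'_def by (rule smooth_on_has_derivative[OF _ y])
  qed
  have g'': "((\<lambda>z. ?g j i (fst z)) has_derivative (\<lambda>h. g' j i (fst h))) (at (y, x))" for j i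
    using diff_chain_at[OF has_derivative_fst[OF has_derivative_ident], of "?g j i" "g' j i" "(y, x)"] g'
    by (simp add: o_def)
  have "((\<lambda>z. \<Sum>i\<in>Basis. (\<Sum>j\<in>Basis. (snd z \<bullet> j) * ?g j i (fst z)) *\<^sub>R i) has_derivative
     (\<lambda>h. \<Sum>i\<in>Basis. (\<Sum>j\<in>Basis. (x \<bullet> j) * g' j i (fst h) + (snd h \<bullet> j) * ?g j i y) *\<^sub>R i)) (at (y, x))"
    by (rule derivative_eq_intros g'' refl | simp)+
  then have "((\<lambda>z. gram \<rho> c (chart_inv c (fst z)) (snd z)) has_derivative
     (\<lambda>h. \<Sum>i\<in>Basis. (\<Sum>j\<in>Basis. (x \<bullet> j) * g' j i (fst h) + (snd h \<bullet> j) * ?g j i y) *\<^sub>R i)) (at (y, x))"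
    by (rule has_derivative_transform_within_open[where s="(snd c ` fst c) \<times> UNIV"])
      (use y O in \<open>auto simp: gram open_Times\<close>)
  also have "(\<lambda>h. \<Sum>i\<in>Basis. (\<Sum>j\<in>Basis. (x \<bullet> j) * g' j i (fst h) + (snd h \<bullet> j) * ?g j i y) *\<^sub>R i)
    = (\<lambda>h. gram \<rho> c (chart_inv c y) (snd h) + (\<Sum>i\<in>Basis. (\<Sum>j\<in>Basis. (x \<bullet> j) * g' j i (fst h)) *\<^sub>R i))"
    by (simp add: gram[OF y] sum.distrib scaleR_add_left add.commute)
  finally show thesis by (rule that[of "\<lambda>a. \<Sum>i\<in>Basis. (\<Sum>j\<in>Basis. (x \<bullet> j) * g' j i a) *\<^sub>R i"])
qed

text \<open>The inverse of the Gram matrix is differentiated through the inverse function theorem applied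
  to \<open>(y, x) \<mapsto> (y, gram y x)\<close>.\<close>

lemma kinetic_differentiable:
  assumes c: "c \<in> A" and y: "y \<in> snd c ` fst c"
  shows "(kinetic A \<rho> \<circ> chart_inv (cotangent_chart A c)) differentiable (at (y, p))"
proof -
  let ?S = "(snd c ` fst c) \<times> (UNIV :: 'e set)"
  let ?q = "chart_inv c y"
  have q: "?q \<in> fst c" by (rule chart_inv_in[OF y])
  define \<Phi> where "\<Phi> = (\<lambda>z. (fst z, gram \<rho> c (chart_inv c (fst z)) (snd z)))"
  \<comment> \<open>A left inverse of \<open>\<Phi>\<close>, built from \<open>sharp\<close>; its
    second component is the velocity belonging to a momentum.\<close>
  define \<Psi> where "\<Psi> = (\<lambda>z. (fst z, snd (sharp A \<rho> (chart_inv (cotangent_chart A c) z)) c))"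
  obtain x where x: "p = gram \<rho> c ?q x" using bij_gram(2)[OF c q] by (metis surjD)
  have o: "open ?S" using open_chart_image[OF c] by (intro open_Times) auto
  have inv: "\<Psi> (\<Phi> z) = z" if "z \<in> ?S" for z
  proof -
    have "fst z \<in> snd c ` fst c" using that by auto
    note i = chart_inv_in[OF this] and ci = chart_inv_cotangent[OF c this]
    show ?thesis
      by (simp add: \<Psi>_def \<Phi>_def ci sharp_covec_gram[OF c i] tangent_of_self[OF c i])
  qed
  have der: "\<exists>K. (\<Phi> has_derivative (\<lambda>h. (fst h, gram \<rho> c (chart_inv c (fst z)) (snd h) + K (fst h)))) (at z)"
    if "z \<in> ?S" for z
  proof -
    have "fst z \<in> snd c ` fst c" using that by auto
    from gram_has_derivative[OF c this, of "snd z"] obtain K where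
      K: "((\<lambda>z. gram \<rho> c (chart_inv c (fst z)) (snd z)) has_derivative
        (\<lambda>h. gram \<rho> c (chart_inv c (fst z)) (snd h) + K (fst h))) (at z)" by auto
    show ?thesis
      unfolding \<Phi>_def
      by (rule exI, rule has_derivative_Pair[OF has_derivative_fst[OF has_derivative_ident] K])
  qed
  have cont: "continuous_on ?S \<Phi>"
  proof (rule continuous_at_imp_continuous_on, rule ballI)
    fix z assume "z \<in> ?S"
    from der[OF this] show "continuous (at z) \<Phi>" by (elim exE) (rule has_derivative_continuous)
  qed
  have zS: "(y, x) \<in> ?S" using y by simp
  obtain K where K: "(\<Phi> has_derivative (\<lambda>h. (fst h, gram \<rho> c ?q (snd h) + K (fst h)))) (at (y, x))"
    using der[OF zS] by auto
  \<comment> \<open>Inverse of the block triangular derivative: subtract the contribution of the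
    base direction, then invert \<open>gram\<close> at the base point.\<close>
  define \<Psi>' where "\<Psi>' = (\<lambda>h. (fst h, inv_into UNIV (gram \<rho> c ?q) (snd h - K (fst h))))"
  have "(\<lambda>h. (fst h, gram \<rho> c ?q (snd h) + K (fst h))) \<circ> \<Psi>' = id"
    using surj_f_inv_f[OF bij_gram(2)[OF c q]] by (simp add: \<Psi>'_def fun_eq_iff)
  from has_derivative_inverse_strong[OF o zS cont inv K this]
  have "(\<Psi> has_derivative \<Psi>') (at (y, p))" by (simp add: \<Phi>_def x)
  from has_derivative_inner[OF has_derivative_snd[OF has_derivative_ident] has_derivative_snd[OF this]]
  have "(\<lambda>z. snd z \<bullet> snd (\<Psi> z)) differentiable (at (y, p))"
    unfolding differentiable_def by blast
  then have "(\<lambda>z. 1/2 * (snd z \<bullet> snd (\<Psi> z))) differentiable (at (y, p))"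
    by (intro differentiable_mult) auto
  then obtain D where "((\<lambda>z. 1/2 * (snd z \<bullet> snd (\<Psi> z))) has_derivative D) (at (y, p))"
    unfolding differentiable_def by blast
  then have "(kinetic A \<rho> \<circ> chart_inv (cotangent_chart A c) has_derivative D) (at (y, p))"
  proof (rule has_derivative_transform_within_open[OF _ o])
    show "(y, p) \<in> ?S" using y by simp
    fix z assume "z \<in> ?S"
    then have zy: "fst z \<in> snd c ` fst c" by auto
    note i = chart_inv_in[OF zy] and ci = chart_inv_cotangent[OF c zy]
    obtain x where x: "snd z = gram \<rho> c (chart_inv c (fst z)) x" using bij_gram(2)[OF c i] by (metis surjD)
    have "chart_inv (cotangent_chart A c) z =
      (chart_inv c (fst z), covec c (chart_inv c (fst z)) (gram \<rho> c (chart_inv c (fst z)) x))"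
      using ci[of "snd z", unfolded prod.collapse] by (simp only: x)
    then show "1/2 * (snd z \<bullet> snd (\<Psi> z)) = (kinetic A \<rho> \<circ> chart_inv (cotangent_chart A c)) z"
      by (simp add: \<Psi>_def kinetic_covec_gram[OF c i] sharp_covec_gram[OF c i] tangent_of_self[OF c i] x)
  qed
  then show ?thesis unfolding differentiable_def by blast
qed

text \<open>By homogeneity of degree two the energy at a momentum is \<open>t\<^sup>2\<close> times
  the energy at that momentum divided by \<open>t\<close>. Near \<open>t *\<^sub>R p\<close> the
  inner point is near \<open>p\<close>, where the derivative is \<open>L\<close>.\<close>

lemma kinetic_derivative_scaleR:
  assumes c: "c \<in> A" and y: "y \<in> snd c ` fst c"
    and L: "((kinetic A \<rho> \<circ> chart_inv (cotangent_chart A c)) has_derivative L) (at (y, p))"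
    and t: "t \<noteq> 0"
  shows "((kinetic A \<rho> \<circ> chart_inv (cotangent_chart A c)) has_derivative
    (\<lambda>h. t\<^sup>2 * L (fst h, (1 / t) *\<^sub>R snd h))) (at (y, t *\<^sub>R p))"
proof -
  let ?k = "kinetic A \<rho> \<circ> chart_inv (cotangent_chart A c)"
  have "((\<lambda>z. (fst z, (1 / t) *\<^sub>R snd z)) has_derivative (\<lambda>h. (fst h, (1 / t) *\<^sub>R snd h))) (at (y, t *\<^sub>R p))"
    by (auto intro!: derivative_eq_intros)
  from diff_chain_at[OF this, of ?k L]
  have "((\<lambda>z. ?k (fst z, (1 / t) *\<^sub>R snd z)) has_derivative (\<lambda>h. L (fst h, (1 / t) *\<^sub>R snd h))) (at (y, t *\<^sub>R p))"
    using L t by (simp add: o_def)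
  then have "((\<lambda>z. t\<^sup>2 * ?k (fst z, (1 / t) *\<^sub>R snd z)) has_derivative
      (\<lambda>h. t\<^sup>2 * L (fst h, (1 / t) *\<^sub>R snd h))) (at (y, t *\<^sub>R p))"
    by (rule has_derivative_mult_right)
  then show ?thesis
  proof (rule has_derivative_transform_within_open[where s="(snd c ` fst c) \<times> UNIV"])
    fix z assume "z \<in> (snd c ` fst c) \<times> (UNIV :: 'e set)"
    then have zy: "fst z \<in> snd c ` fst c" by auto
    have "?k z = kinetic A \<rho> (chart_inv c (fst z), covec c (chart_inv c (fst z)) (snd z))"
      using chart_inv_cotangent[OF c zy, of "snd z"] by simp
    then show "t\<^sup>2 * ?k (fst z, (1 / t) *\<^sub>R snd z) = ?k z"
      using kinetic_covec_scaleR[OF c chart_inv_in[OF zy], of t "(1 / t) *\<^sub>R snd z"] t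
      by (simp add: chart_inv_cotangent[OF c zy])
  qed (use y open_chart_image[OF c] in \<open>auto intro: open_Times\<close>)
qed

end

end

theorem proposition38:
  fixes A :: "('q, 'e::euclidean_space) chart set"
    and \<rho> \<rho>' :: "'q \<Rightarrow> ('q, 'e) tvec \<Rightarrow> ('q, 'e) tvec \<Rightarrow> real"
    and h h' :: "'q \<Rightarrow> real"
    and H H' :: "'q \<times> ('q, 'e) cvec \<Rightarrow> real"
    and W :: "('q \<times> ('q, 'e) cvec) set"
    and \<mu> :: "'q \<times> ('q, 'e) cvec \<Rightarrow> real"
  assumes "smooth_manifold A"
    and "riemannian_metric A \<rho>" and "smooth_fun A h" and "H = simple_hamiltonian A \<rho> h"
    and "linear_subbundle A W"
    and "riemannian_metric A \<rho>'" and "smooth_fun A h'" and "H' = simple_hamiltonian A \<rho>' h'"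
    and "smooth_fun (cotangent_atlas A) \<mu>" and "\<forall>\<alpha>\<in>cotangent_bundle A. \<mu> \<alpha> \<ge> 0"
    and "\<exists>y. smooth_map (cotangent_atlas A) (cotangent_atlas A) y \<and>
          (\<forall>\<alpha>\<in>cotangent_bundle A. fst (y \<alpha>) = fst \<alpha>) \<and>
          (\<forall>\<alpha>\<in>cotangent_bundle A.
             pairing (y \<alpha>) (fiber_derivative A H' \<alpha>) = - \<mu> \<alpha> - poisson_bracket A H' H \<alpha> \<and>
             y \<alpha> \<in> W)"
  shows "\<forall>nabla. is_connection A nabla \<and> torsion_free A nabla \<longrightarrow>
    (\<forall>\<sigma>\<in>{\<sigma> \<in> cotangent_bundle A.
           fiber_derivative A (kinetic A \<rho>') \<sigma> \<in> annihilator A W}.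
       pairing (base_derivative A nabla (kinetic A \<rho>') \<sigma>)
               (fiber_derivative A (kinetic A \<rho>) \<sigma>) -
       pairing (base_derivative A nabla (kinetic A \<rho>) \<sigma>)
               (fiber_derivative A (kinetic A \<rho>') \<sigma>) = 0 \<and>
       pairing (differential A h' (fst \<sigma>)) (fiber_derivative A (kinetic A \<rho>) \<sigma>) -
       pairing (differential A h (fst \<sigma>)) (fiber_derivative A (kinetic A \<rho>') \<sigma>) = 0)"
proof (intro allI impI ballI)
  interpret smooth_atlas A by unfold_locales (rule assms(1))
  note R = assms(2) and H = assms(4) and R' = assms(6) and H' = assms(8)
  fix nabla \<sigma>
  assume "is_connection A nabla \<and> torsion_free A nabla"
    and \<sigma>: "\<sigma> \<in> {\<sigma> \<in> cotangent_bundle A.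
      fiber_derivative A (kinetic A \<rho>') \<sigma> \<in> annihilator A W}"
  then have C: "is_connection A nabla" "torsion_free A nabla" by auto
  obtain q \<alpha> where \<sigma>_eq: "\<sigma> = (q, \<alpha>)" by (cases \<sigma>)
  have q: "q \<in> points A" and \<alpha>: "\<alpha> \<in> cotangent_space A q"
    and ann: "fiber_derivative A (kinetic A \<rho>') (q, \<alpha>) \<in> annihilator A W"
    using \<sigma> by (auto simp: \<sigma>_eq cotangent_bundle_def)
  define c where "c = chart_at A q"
  have c: "c \<in> A" "q \<in> fst c" using chart_at[OF q] by (auto simp: c_def)
  let ?k = "cotangent_chart A c"
  define y where "y = snd c q"
  define p where "p = comps c q \<alpha>"
  have y: "y \<in> snd c ` fst c" using c by (simp add: y_def)
  obtain L where L: "(kinetic A \<rho> \<circ> chart_inv ?k has_derivative L) (at (y, p))"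
    using kinetic_differentiable[OF R c(1) y] unfolding differentiable_def by blast
  obtain L' where L': "(kinetic A \<rho>' \<circ> chart_inv ?k has_derivative L') (at (y, p))"
    using kinetic_differentiable[OF R' c(1) y] unfolding differentiable_def by blast
  have dh_ex: "\<exists>l. (f \<circ> chart_inv c has_derivative l) (at y)" if "smooth_fun A f" for f
  proof -
    have "smooth_on (snd c ` (fst c \<inter> points A)) (f \<circ> chart_inv c)"
      using that c(1) unfolding smooth_fun_def smooth_fun_on_iff by blast
    moreover have "fst c \<inter> points A = fst c" using in_points[OF c(1)] by blast
    ultimately show ?thesis using smooth_on_has_derivative[of "snd c ` fst c" _ y] y by auto
  qed
  obtain l where l: "(h \<circ> chart_inv c has_derivative l) (at y)" using dh_ex[OF assms(3)] by blast
  obtain l' where l': "(h' \<circ> chart_inv c has_derivative l') (at y)" using dh_ex[OF assms(7)] by blast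

  \<comment> \<open>The derivative of a kinetic energy at \<open>t *\<^sub>R \<alpha>\<close>,
    expressed through its derivative at \<alpha>. Position directions acquire
    \<open>t\<^sup>2\<close>, momentum directions only \<open>t\<close>.\<close>
  define S where "S = (\<lambda>(L::'e \<times> 'e \<Rightarrow> real) (t::real) (z::'e \<times> 'e). t\<^sup>2 * L (fst z, (1 / t) *\<^sub>R snd z) :: real)"
  have der: "(simple_hamiltonian A r f \<circ> chart_inv ?k has_derivative (\<lambda>z. S D t z + d (fst z)))
      (at (snd c q, comps c q (t *\<^sub>R \<alpha>)))"
    if r: "riemannian_metric A r" and D: "(kinetic A r \<circ> chart_inv ?k has_derivative D) (at (y, p))"
      and d: "(f \<circ> chart_inv c has_derivative d) (at y)" and t: "t \<noteq> 0" for r f D d t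
  proof -
    have "comps c q (t *\<^sub>R \<alpha>) = t *\<^sub>R p"
      by (simp add: comps_def p_def scaleR_fun_def scaleR_sum_right)
    moreover have "((\<lambda>z. (f \<circ> chart_inv c) (fst z)) has_derivative (\<lambda>z. d (fst z))) (at (y, t *\<^sub>R p))"
      using diff_chain_at[OF has_derivative_fst[OF has_derivative_ident], of "f \<circ> chart_inv c" d "(y, t *\<^sub>R p)"] d
      by (simp add: o_def)
    from has_derivative_add[OF kinetic_derivative_scaleR[OF r c(1) y D t] this]
    have "(simple_hamiltonian A r f \<circ> chart_inv ?k has_derivative (\<lambda>z. S D t z + d (fst z))) (at (y, t *\<^sub>R p))"
      unfolding S_def
    proof (rule has_derivative_transform_within_open[where s="(snd c ` fst c) \<times> UNIV"])
      fix z assume "z \<in> (snd c ` fst c) \<times> (UNIV :: 'e set)"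
      then have "fst z \<in> snd c ` fst c" by auto
      from chart_inv_cotangent[OF c(1) this, of "snd z"]
      show "(kinetic A r \<circ> chart_inv ?k) z + (f \<circ> chart_inv c) (fst z) = (simple_hamiltonian A r f \<circ> chart_inv ?k) z"
        by (simp add: simple_hamiltonian_def)
    qed (use y open_chart_image[OF c(1)] in \<open>auto intro: open_Times\<close>)
    ultimately show ?thesis by (simp only: y_def)
  qed

  define P1 where "P1 = (\<Sum>i\<in>Basis. l' i * L (0, i) - l i * L' (0, i))"
  define P3 where "P3 = (\<Sum>i\<in>Basis. L' (i, 0) * L (0, i) - L (i, 0) * L' (0, i))"
  note lin = has_derivative_linear[OF L] has_derivative_linear[OF L']
  have S_simps: "S D t (i, 0) = t\<^sup>2 * D (i, 0)" "S D t (0, i) = t * D (0, i)"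
    if "linear D" "t \<noteq> 0" for D t i
    using linear_cmul[OF that(1), of "1/t" "(0, i)"] that(2)
    by (simp_all add: S_def power2_eq_square)
  have \<alpha>t: "t *\<^sub>R \<alpha> \<in> cotangent_space A q" for t
    using \<alpha> unfolding cotangent_space_def by (auto simp: scaleR_fun_def algebra_simps)
  \<comment> \<open>Each summand multiplies a position derivative by a momentum derivative. The
    latter always scales by \<open>t\<close>; the former by \<open>t\<^sup>2\<close> from the metric
    and by 1 from the potential, whence the exponents 3 and 1.\<close>
  have bracket: "poisson_bracket A H' H (q, t *\<^sub>R \<alpha>) = t ^ 3 * P3 + t * P1" if t: "t \<noteq> 0" for t
  proof -
    have "poisson_bracket A H' H (q, t *\<^sub>R \<alpha>) =
      (\<Sum>i\<in>Basis. (t\<^sup>2 * L' (i, 0) + l' i) * (t * L (0, i)) - (t\<^sup>2 * L (i, 0) + l i) * (t * L' (0, i)))"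
      unfolding H H'
      by (subst poisson_bracket_in_chart[OF c_def der[OF R' L' l' t] der[OF R L l t]])
        (simp add: S_simps[OF lin(1) t] S_simps[OF lin(2) t] linear_0[OF has_derivative_linear[OF l]]
          linear_0[OF has_derivative_linear[OF l']])
    also have "\<dots> = (\<Sum>i\<in>Basis. t ^ 3 * (L' (i, 0) * L (0, i) - L (i, 0) * L' (0, i)) +
        t * (l' i * L (0, i) - l i * L' (0, i)))"
      by (intro sum.cong refl) (simp add: algebra_simps power2_eq_square power3_eq_cube)
    finally show ?thesis by (simp only: P1_def P3_def sum.distrib sum_distrib_left)
  qed

  obtain Y where Y: "\<And>\<beta>. \<beta> \<in> cotangent_bundle A \<Longrightarrow> fst (Y \<beta>) = fst \<beta>"
    "\<And>\<beta>. \<beta> \<in> cotangent_bundle A \<Longrightarrow> pairing (Y \<beta>) (fiber_derivative A H' \<beta>) = - \<mu> \<beta> - poisson_bracket A H' H \<beta>"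
    "\<And>\<beta>. \<beta> \<in> cotangent_bundle A \<Longrightarrow> Y \<beta> \<in> W"
    using assms(11) by blast
  have L_at: "(kinetic A \<rho> \<circ> chart_inv ?k has_derivative L) (at (snd c q, comps c q \<alpha>))"
    "(kinetic A \<rho>' \<circ> chart_inv ?k has_derivative L') (at (snd c q, comps c q \<alpha>))"
    using L L' by (simp_all add: y_def p_def)
  define x where "x = (\<Sum>i\<in>Basis. L (0, i) *\<^sub>R i)"
  define x' where "x' = (\<Sum>i\<in>Basis. L' (0, i) *\<^sub>R i)"
  have F: "fiber_derivative A (kinetic A \<rho>) (q, \<alpha>) = (q, tangent_of A c q x)"
    and F': "fiber_derivative A (kinetic A \<rho>') (q, \<alpha>) = (q, tangent_of A c q x')"
    unfolding x_def x'_def by (rule fiber_derivative_in_chart[OF c \<alpha>], rule L_at)+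
  have le: "t ^ 3 * P3 + t * P1 \<le> 0" if t: "t \<noteq> 0" for t
  proof -
    have tb: "(q, t *\<^sub>R \<alpha>) \<in> cotangent_bundle A" using \<alpha>t q by (simp add: cotangent_bundle_def)
    obtain \<beta> where \<beta>: "Y (q, t *\<^sub>R \<alpha>) = (q, \<beta>)" using Y(1)[OF tb] by (metis fst_conv prod.collapse)
    then have \<beta>W: "(q, \<beta>) \<in> W" using Y(3)[OF tb] by simp
    then have \<beta>c: "\<beta> \<in> cotangent_space A q"
      using assms(5) unfolding linear_subbundle_def cotangent_bundle_def by blast
    \<comment> \<open>The potential is constant on fibers and the kinetic part has a fiber
      derivative linear in the momentum, so the vector at \<open>t *\<^sub>R \<alpha>\<close> is
      \<open>t\<close> times the one at \<alpha>.\<close>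
    have "fiber_derivative A H' (q, t *\<^sub>R \<alpha>) = (q, tangent_of A c q (t *\<^sub>R x'))"
      unfolding H' x'_def
      by (subst fiber_derivative_in_chart[OF c \<alpha>t der[OF R' L' l' t]])
        (simp add: S_simps[OF lin(2) t] linear_0[OF has_derivative_linear[OF l']] scaleR_sum_right)
    then have "pairing (Y (q, t *\<^sub>R \<alpha>)) (fiber_derivative A H' (q, t *\<^sub>R \<alpha>)) = t * \<beta> (tangent_of A c q x')"
      by (simp add: \<beta> pairing_def linear_cmul[OF linear_tangent_of[OF c]]
          cotangent_space_scaleR[OF \<beta>c tangent_of_in[OF c]])
    \<comment> \<open>Here the choice of \<sigma> enters: its fiber derivative annihilates
      \<open>W\<close>, and \<open>Y\<close> takes values in \<open>W\<close>.\<close>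
    also have "\<beta> (tangent_of A c q x') = 0"
      using ann \<beta>W unfolding F' annihilator_def by (auto simp: pairing_def)
    finally show ?thesis
      using Y(2)[OF tb] bracket[OF t] bspec[OF assms(10) tb] by simp
  qed
  \<comment> \<open>Opposite values of \<open>t\<close> turn the inequality into an equation: t = 1
    and -1 give P3 + P1 = 0, while t = 2 and -2 give 8 P3 + 2 P1 = 0, an independent
    equation.\<close>
  have "P3 = 0" "P1 = 0" using le[of 1] le[of "-1"] le[of 2] le[of "-2"] by simp_all
  moreover have "pairing (base_derivative A nabla (kinetic A \<rho>') \<sigma>) (fiber_derivative A (kinetic A \<rho>) \<sigma>) -
      pairing (base_derivative A nabla (kinetic A \<rho>) \<sigma>) (fiber_derivative A (kinetic A \<rho>') \<sigma>) = P3"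
    unfolding \<sigma>_eq P3_def
    by (simp only: poisson_bracket_base_fiber[OF C q \<alpha> c_def L_at(2,1)]
        poisson_bracket_in_chart[OF c_def L_at(2,1)])
  moreover have "pairing (differential A h' (fst \<sigma>)) (fiber_derivative A (kinetic A \<rho>) \<sigma>) -
      pairing (differential A h (fst \<sigma>)) (fiber_derivative A (kinetic A \<rho>') \<sigma>) = P1"
  proof -
    have "pairing (differential A f q) (q, tangent_of A c q (\<Sum>i\<in>Basis. u i *\<^sub>R i)) = (\<Sum>i\<in>Basis. d i * u i)"
      if d: "(f \<circ> chart_inv c has_derivative d) (at y)" for f d u
    proof -
      note dl = has_derivative_linear[OF d]
      have "pairing (differential A f q) (q, tangent_of A c q v) = d v" for v
        using differential_in_chart[OF c tangent_of_in[OF c, of v], of f d] d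
        by (simp add: y_def tangent_of_self[OF c])
      then show ?thesis by (simp add: linear_sum[OF dl] linear_cmul[OF dl] mult.commute)
    qed
    from this[OF l'] this[OF l] show ?thesis
      by (simp add: \<sigma>_eq F F' x_def x'_def P1_def sum_subtractf)
  qed
  ultimately show "pairing (base_derivative A nabla (kinetic A \<rho>') \<sigma>) (fiber_derivative A (kinetic A \<rho>) \<sigma>) -
      pairing (base_derivative A nabla (kinetic A \<rho>) \<sigma>) (fiber_derivative A (kinetic A \<rho>') \<sigma>) = 0 \<and>
      pairing (differential A h' (fst \<sigma>)) (fiber_derivative A (kinetic A \<rho>) \<sigma>) -
      pairing (differential A h (fst \<sigma>)) (fiber_derivative A (kinetic A \<rho>') \<sigma>) = 0"
    by simp
qed

end
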